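(* Let $d>0$. If the defining polynomials $g_1,\dots,g_m,h_1,\dots,h_r\in\mathbb{R}[x]$ (of given degrees) of the semialgebraic set $S=\{x\in\mathbb{R}^n: g_1(x)\ge0,\dots,g_m(x)\ge0,\ h_1(x)=0,\dots,h_r(x)=0\}$ are chosen generically, and $p$ is chosen generically among the polynomials in $\mathbb{R}_d[x]$ that are bounded below on $S$, then $\tilde p(x)>0$ for all $x\in\tilde S\setminus\{0\}$.
   Context: $\mathbb{R}_d[x]$ is the space of real polynomials in $x=(x_1,\dots,x_n)$ of degree at most $d$. A property holds generically (or for a generically chosen element) in a given set if it holds for all elements of the set except for a subset of Lebesgue measure zero (polynomials of bounded degree being identified with their coefficient vectors). For a polynomial $q$, $\tilde q$ denotes its homogeneous component of highest total degree, and $\tilde S=\{x\in\mathbb{R}^n:\tilde g_1(x)\ge0,\dots,\tilde g_m(x)\ge0,\ \tilde h_1(x)=0,\dots,\tilde h_r(x)=0\}$. *)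

theory Defs
  imports "HOL-Analysis.Analysis" "HOL-Library.Poly_Mapping"
begin

text \<open>Monomials over the finite set of variables \<open>'n\<close> are represented by their exponent vectors.\<close>

type_synonym 'n mpoly = "('n \<Rightarrow>\<^sub>0 nat) \<Rightarrow>\<^sub>0 real"

definition mono_degree :: "('n::finite \<Rightarrow>\<^sub>0 nat) \<Rightarrow> nat" where
  "mono_degree \<alpha> = (\<Sum>i\<in>UNIV. Poly_Mapping.lookup \<alpha> i)"

definition monos_upto :: "nat \<Rightarrow> ('n::finite \<Rightarrow>\<^sub>0 nat) set" where
  "monos_upto d = {\<alpha>. mono_degree \<alpha> \<le> d}"

lemma finite_monos_upto: "finite (monos_upto d :: ('n::finite \<Rightarrow>\<^sub>0 nat) set)"
proof -
  have "Poly_Mapping.lookup a i \<le> d" if "a \<in> monos_upto d" for a :: "'n \<Rightarrow>\<^sub>0 nat" and i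
  proof -
    have "Poly_Mapping.lookup a i \<le> (\<Sum>i\<in>UNIV. Poly_Mapping.lookup a i)"
      by (intro member_le_sum) auto
    with that show ?thesis by (simp add: monos_upto_def mono_degree_def)
  qed
  then have "Poly_Mapping.lookup ` (monos_upto d :: ('n \<Rightarrow>\<^sub>0 nat) set) \<subseteq> (\<Pi>\<^sub>E i\<in>UNIV. {..d})"
    by (auto simp: PiE_def Pi_def)
  moreover have "finite ((\<Pi>\<^sub>E i\<in>(UNIV::'n set). {..d}) :: ('n \<Rightarrow> nat) set)"
    by (intro finite_PiE) auto
  ultimately have "finite (Poly_Mapping.lookup ` (monos_upto d :: ('n \<Rightarrow>\<^sub>0 nat) set))"
    by (rule finite_subset)
  then show ?thesis
    by (rule finite_imageD) (auto simp: inj_on_def poly_mapping_eqI)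
qed

definition polys_upto :: "nat \<Rightarrow> 'n::finite mpoly set" where
  "polys_upto d = {p. Poly_Mapping.keys p \<subseteq> monos_upto d}"

lemma inj_on_coefficients:
  "inj_on (\<lambda>p. restrict (Poly_Mapping.lookup p) (monos_upto d)) (polys_upto d)"
proof (rule inj_onI, rule poly_mapping_eqI)
  fix p q :: "'a mpoly" and k
  assume a: "p \<in> polys_upto d" "q \<in> polys_upto d"
    "restrict (Poly_Mapping.lookup p) (monos_upto d) = restrict (Poly_Mapping.lookup q) (monos_upto d)"
  show "Poly_Mapping.lookup p k = Poly_Mapping.lookup q k"
  proof (cases "k \<in> monos_upto d")
    case True
    then show ?thesis using fun_cong[OF a(3), of k] by simp
  next
    case False
    then have "k \<notin> Poly_Mapping.keys p" "k \<notin> Poly_Mapping.keys q"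
      using a(1,2) by (auto simp: polys_upto_def)
    then show ?thesis by (simp add: in_keys_iff)
  qed
qed

definition peval :: "'n::finite mpoly \<Rightarrow> real ^ 'n \<Rightarrow> real" where
  "peval p x = (\<Sum>\<alpha>\<in>Poly_Mapping.keys p.
     Poly_Mapping.lookup p \<alpha> * (\<Prod>i\<in>UNIV. (x $ i) ^ Poly_Mapping.lookup \<alpha> i))"

text \<open>The zero polynomial has total degree \<open>0\<close>, and its highest component is \<open>0\<close>.\<close>

definition total_degree :: "'n::finite mpoly \<Rightarrow> nat" where
  "total_degree p = Max (insert 0 (mono_degree ` Poly_Mapping.keys p))"

definition hom_component :: "nat \<Rightarrow> 'n::finite mpoly \<Rightarrow> 'n mpoly" where
  "hom_component k p = (\<Sum>\<alpha>\<in>{\<alpha> \<in> Poly_Mapping.keys p. mono_degree \<alpha> = k}.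
     Poly_Mapping.single \<alpha> (Poly_Mapping.lookup p \<alpha>))"

definition highest_component :: "'n::finite mpoly \<Rightarrow> 'n mpoly" where
  "highest_component p = hom_component (total_degree p) p"

definition semialg_set ::
  "nat \<Rightarrow> nat \<Rightarrow> (nat \<Rightarrow> 'n::finite mpoly) \<Rightarrow> (nat \<Rightarrow> 'n mpoly) \<Rightarrow> (real ^ 'n) set" where
  "semialg_set m r g h = {x. (\<forall>i<m. peval (g i) x \<ge> 0) \<and> (\<forall>j<r. peval (h j) x = 0)}"

text \<open>
  An object \<open>q\<close> in \<open>A\<close> is identified with its coefficient vector \<open>coef q\<close>, indexed by the
  finite set \<open>J\<close>; \<open>coef\<close> restricted to \<open>J\<close> has to be injective on \<open>A\<close>. The completed
  product of \<open>lborel\<close> over \<open>J\<close> is Lebesgue measure on the space of all such vectors, so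
  exceptional sets are arbitrary Lebesgue null sets, not only Borel ones.
\<close>

definition generically ::
  "'j set \<Rightarrow> ('q \<Rightarrow> 'j \<Rightarrow> real) \<Rightarrow> 'q set \<Rightarrow> ('q \<Rightarrow> bool) \<Rightarrow> bool" where
  "generically J coef A P \<longleftrightarrow>
     (\<lambda>q. restrict (coef q) J) ` {q \<in> A. \<not> P q}
       \<in> null_sets (completion (\<Pi>\<^sub>M j\<in>J. (lborel :: real measure)))"

definition generic_poly :: "nat \<Rightarrow> 'n::finite mpoly set \<Rightarrow> ('n mpoly \<Rightarrow> bool) \<Rightarrow> bool" where
  "generic_poly d A P \<longleftrightarrow> generically (monos_upto d) Poly_Mapping.lookup (A \<inter> polys_upto d) P"

text \<open>
  All defining polynomials are chosen at once: the coefficient vector of the pair \<open>(g, h)\<close>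
  is the concatenation of those of all the \<open>g i\<close> and \<open>h j\<close>.
\<close>

definition generic_system ::
  "nat \<Rightarrow> nat \<Rightarrow> (nat \<Rightarrow> nat) \<Rightarrow> (nat \<Rightarrow> nat) \<Rightarrow>
   ((nat \<Rightarrow> 'n::finite mpoly) \<Rightarrow> (nat \<Rightarrow> 'n mpoly) \<Rightarrow> bool) \<Rightarrow> bool" where
  "generic_system m r dg dh P \<longleftrightarrow>
     generically
       ((SIGMA i:{..<m}. monos_upto (dg i)) <+> (SIGMA j:{..<r}. monos_upto (dh j)))
       (\<lambda>(g, h). case_sum (\<lambda>(i, \<alpha>). Poly_Mapping.lookup (g i) \<alpha>)
                          (\<lambda>(j, \<alpha>). Poly_Mapping.lookup (h j) \<alpha>))
       ((\<Pi>\<^sub>E i\<in>{..<m}. polys_upto (dg i)) \<times> (\<Pi>\<^sub>E j\<in>{..<r}. polys_upto (dh j)))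
       (\<lambda>(g, h). P g h)"

end

theory Submission imports Defs begin

text \<open>
  Write \<open>p\<^sub>d\<close> for the part of degree \<open>d\<close> of \<open>p\<close>, and similarly for the \<open>g\<^sub>i\<close> and \<open>h\<^sub>j\<close> with
  their prescribed degrees. Off the hyperplanes where the coefficient of a pure power \<open>x\<^sub>k\<^sup>d\<close>
  vanishes, these parts are the highest components. Two facts combine.

  First, for a generic system every ray spanned by a point \<open>x \<noteq> 0\<close> of the cone \<open>S~\<close> of the highest
  components is a limit of directions of points of \<open>S\<close> going to infinity, so that \<open>p\<^sub>d(x) \<ge> 0\<close> for every
  \<open>p\<close> bounded below on \<open>S\<close>. The reason is transversality: generically the gradients of the highest
  components of the constraints active at \<open>x\<close> are linearly independent. Substituting \<open>y / s\<close> for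
  the variables and clearing denominators turns the constraints into functions of \<open>(y, s)\<close> whose
  restrictions to \<open>s = 0\<close> are the highest components; by independence, zeros of the active ones near
  \<open>(x, 0)\<close> persist for small \<open>s > 0\<close> (\<open>solutions_persist\<close>), while the other constraints stay
  positive. The points \<open>y / s\<close> are the desired points of \<open>S\<close>, and \<open>p(y / s)\<close> behaves like
  \<open>p\<^sub>d(x) / s\<^sup>d\<close> (\<open>form_nonneg_at_regular_direction\<close>).

  That independence is generic is a dimension count. On the chart \<open>x\<^sub>k = \<plusminus>1\<close>, a dependent system
  satisfies one equation per active constraint, and \<open>n - 1\<close> more equations saying that one
  gradient is a combination of the others. They can be solved explicitly for as many coefficients
  in terms of the other coefficients, the \<open>n - 1\<close> free coordinates of \<open>x\<close> and the multipliers,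
  which are one fewer than the active constraints. So dependent systems form the image of a
  locally Lipschitz map from a space of one dimension less, which is null
  (\<open>null_dependent_gradients\<close>, \<open>null_image\<close>). This explicit elimination replaces Sard's theorem.

  Secondly, if \<open>p\<^sub>d \<ge> 0\<close> on \<open>S~\<close> and \<open>p\<^sub>d(x) = 0\<close> at some \<open>x\<close> of \<open>S~\<close> with \<open>x\<^sub>k \<noteq> 0\<close>, then a change
  of the coefficient of \<open>x\<^sub>k\<^sup>d\<close> in one direction destroys nonnegativity. Thus such \<open>p\<close>, for a fixed
  \<open>k\<close> and a fixed sign of \<open>x\<^sub>k\<close>, meet every line in that coefficient direction at most once, and
  are null by Fubini (\<open>null_touching_forms\<close>).
\<close>

section \<open>Null sets of coefficient vectors\<close>

text \<open>
  Lipschitz continuity, in the maximum norm, on every box in the parameters \<open>P\<close>. It implies that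
  \<open>f\<close> depends on the parameters in \<open>P\<close> only. Polynomial functions have it because it is inherited by
  sums and products.
\<close>

definition boxwise_lipschitz :: "'p set \<Rightarrow> (('p \<Rightarrow> real) \<Rightarrow> real) \<Rightarrow> bool" where
  "boxwise_lipschitz P f \<longleftrightarrow> (\<forall>R. \<exists>L\<ge>0. \<forall>u v \<delta>.
     (\<forall>p\<in>P. \<bar>u p\<bar> \<le> R \<and> \<bar>v p\<bar> \<le> R \<and> \<bar>u p - v p\<bar> \<le> \<delta>) \<longrightarrow> 0 \<le> \<delta> \<longrightarrow> \<bar>f u - f v\<bar> \<le> L * \<delta>)"

lemma boxwise_lipschitz_const [intro]: "boxwise_lipschitz P (\<lambda>u. c)"
  unfolding boxwise_lipschitz_def by (auto intro!: exI[of _ 0])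

lemma boxwise_lipschitz_coord [intro]: "p \<in> P \<Longrightarrow> boxwise_lipschitz P (\<lambda>u. u p)"
  unfolding boxwise_lipschitz_def by (auto intro!: exI[of _ 1])

lemma boxwise_lipschitz_add [intro]:
  assumes "boxwise_lipschitz P f" "boxwise_lipschitz P g"
  shows "boxwise_lipschitz P (\<lambda>u. f u + g u)"
  unfolding boxwise_lipschitz_def
proof
  fix R :: real
  obtain L where L: "L \<ge> 0" "\<And>u v \<delta>. \<forall>p\<in>P. \<bar>u p\<bar> \<le> R \<and> \<bar>v p\<bar> \<le> R \<and> \<bar>u p - v p\<bar> \<le> \<delta> \<Longrightarrow> 0 \<le> \<delta> \<Longrightarrow> \<bar>f u - f v\<bar> \<le> L * \<delta>"
    using assms(1) unfolding boxwise_lipschitz_def by metis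
  obtain M where M: "M \<ge> 0" "\<And>u v \<delta>. \<forall>p\<in>P. \<bar>u p\<bar> \<le> R \<and> \<bar>v p\<bar> \<le> R \<and> \<bar>u p - v p\<bar> \<le> \<delta> \<Longrightarrow> 0 \<le> \<delta> \<Longrightarrow> \<bar>g u - g v\<bar> \<le> M * \<delta>"
    using assms(2) unfolding boxwise_lipschitz_def by metis
  have "\<bar>f u + g u - (f v + g v)\<bar> \<le> (L + M) * \<delta>"
    if "\<forall>p\<in>P. \<bar>u p\<bar> \<le> R \<and> \<bar>v p\<bar> \<le> R \<and> \<bar>u p - v p\<bar> \<le> \<delta>" "0 \<le> \<delta>" for u v \<delta>
    using L(2)[OF that] M(2)[OF that] by (simp add: algebra_simps)
  then show "\<exists>L\<ge>0. \<forall>u v \<delta>. (\<forall>p\<in>P. \<bar>u p\<bar> \<le> R \<and> \<bar>v p\<bar> \<le> R \<and> \<bar>u p - v p\<bar> \<le> \<delta>) \<longrightarrow> 0 \<le> \<delta>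
      \<longrightarrow> \<bar>f u + g u - (f v + g v)\<bar> \<le> L * \<delta>"
    using L(1) M(1) by (intro exI[of _ "L + M"]) auto
qed

lemma boxwise_lipschitz_bounded:
  assumes "boxwise_lipschitz P f"
  obtains B where "\<And>u. (\<forall>p\<in>P. \<bar>u p\<bar> \<le> R) \<Longrightarrow> \<bar>f u\<bar> \<le> B"
proof (cases "R \<ge> 0")
  case True
  obtain L where L: "L \<ge> 0" "\<And>u v \<delta>. \<forall>p\<in>P. \<bar>u p\<bar> \<le> R \<and> \<bar>v p\<bar> \<le> R \<and> \<bar>u p - v p\<bar> \<le> \<delta> \<Longrightarrow> 0 \<le> \<delta> \<Longrightarrow> \<bar>f u - f v\<bar> \<le> L * \<delta>"
    using assms(1) unfolding boxwise_lipschitz_def by metis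
  have "\<bar>f u\<bar> \<le> L * R + \<bar>f (\<lambda>_. 0)\<bar>" if "\<forall>p\<in>P. \<bar>u p\<bar> \<le> R" for u
    using L(2)[of u "\<lambda>_. 0" R] that True by simp
  then show ?thesis by (rule that)
next
  case False
  show ?thesis
  proof (cases "P = {}")
    case True
    \<comment> \<open>Without parameters \<open>f\<close> is constant.\<close>
    have "f u = f (\<lambda>_. 0)" for u
      using assms True unfolding boxwise_lipschitz_def
      by (metis abs_le_zero_iff empty_iff eq_iff_diff_eq_0 mult_zero_right order_refl)
    then show ?thesis by (intro that[of "\<bar>f (\<lambda>_. 0)\<bar>"]) (metis order_refl)
  next
    case nonempty: False
    then show ?thesis using False that by (metis abs_ge_zero all_not_in_conv order_trans)
  qed
qed

lemma boxwise_lipschitz_mult [intro]: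
  assumes "boxwise_lipschitz P f" "boxwise_lipschitz P g"
  shows "boxwise_lipschitz P (\<lambda>u. f u * g u)"
  unfolding boxwise_lipschitz_def
proof
  fix R :: real
  obtain L where L: "L \<ge> 0" "\<And>u v \<delta>. \<forall>p\<in>P. \<bar>u p\<bar> \<le> R \<and> \<bar>v p\<bar> \<le> R \<and> \<bar>u p - v p\<bar> \<le> \<delta> \<Longrightarrow> 0 \<le> \<delta> \<Longrightarrow> \<bar>f u - f v\<bar> \<le> L * \<delta>"
    using assms(1) unfolding boxwise_lipschitz_def by metis
  obtain M where M: "M \<ge> 0" "\<And>u v \<delta>. \<forall>p\<in>P. \<bar>u p\<bar> \<le> R \<and> \<bar>v p\<bar> \<le> R \<and> \<bar>u p - v p\<bar> \<le> \<delta> \<Longrightarrow> 0 \<le> \<delta> \<Longrightarrow> \<bar>g u - g v\<bar> \<le> M * \<delta>"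
    using assms(2) unfolding boxwise_lipschitz_def by metis
  obtain B where B: "\<And>u. (\<forall>p\<in>P. \<bar>u p\<bar> \<le> R) \<Longrightarrow> \<bar>f u\<bar> \<le> B"
    using boxwise_lipschitz_bounded[OF assms(1)] by metis
  obtain C where C: "\<And>u. (\<forall>p\<in>P. \<bar>u p\<bar> \<le> R) \<Longrightarrow> \<bar>g u\<bar> \<le> C"
    using boxwise_lipschitz_bounded[OF assms(2)] by metis
  have "\<bar>f u * g u - f v * g v\<bar> \<le> (\<bar>B\<bar> * M + \<bar>C\<bar> * L) * \<delta>"
    if *: "\<forall>p\<in>P. \<bar>u p\<bar> \<le> R \<and> \<bar>v p\<bar> \<le> R \<and> \<bar>u p - v p\<bar> \<le> \<delta>" "0 \<le> \<delta>" for u v \<delta>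
  proof -
    have "f u * g u - f v * g v = f u * (g u - g v) + g v * (f u - f v)"
      by (simp add: algebra_simps)
    also have "\<bar>\<dots>\<bar> \<le> \<bar>f u\<bar> * \<bar>g u - g v\<bar> + \<bar>g v\<bar> * \<bar>f u - f v\<bar>"
      by (metis abs_mult abs_triangle_ineq)
    also have "\<dots> \<le> \<bar>B\<bar> * (M * \<delta>) + \<bar>C\<bar> * (L * \<delta>)"
      using L(2)[OF *] M(2)[OF *] B[of u] C[of v] * L(1) M(1)
      by (intro add_mono mult_mono) fastforce+
    finally show ?thesis by (simp add: algebra_simps)
  qed
  then show "\<exists>L\<ge>0. \<forall>u v \<delta>. (\<forall>p\<in>P. \<bar>u p\<bar> \<le> R \<and> \<bar>v p\<bar> \<le> R \<and> \<bar>u p - v p\<bar> \<le> \<delta>) \<longrightarrow> 0 \<le> \<delta>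
      \<longrightarrow> \<bar>f u * g u - f v * g v\<bar> \<le> L * \<delta>"
    using L(1) M(1) by (intro exI[of _ "\<bar>B\<bar> * M + \<bar>C\<bar> * L"]) auto
qed

lemma boxwise_lipschitz_sum [intro]:
  "(\<And>a. a \<in> S \<Longrightarrow> boxwise_lipschitz P (f a)) \<Longrightarrow> boxwise_lipschitz P (\<lambda>u. \<Sum>a\<in>S. f a u)"
  by (induction S rule: infinite_finite_induct) auto

lemma boxwise_lipschitz_prod [intro]:
  "(\<And>a. a \<in> S \<Longrightarrow> boxwise_lipschitz P (f a)) \<Longrightarrow> boxwise_lipschitz P (\<lambda>u. \<Prod>a\<in>S. f a u)"
  by (induction S rule: infinite_finite_induct) auto

lemma boxwise_lipschitz_power [intro]:
  "boxwise_lipschitz P f \<Longrightarrow> boxwise_lipschitz P (\<lambda>u. f u ^ k)"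
  by (induction k) auto

lemma boxwise_lipschitz_diff [intro]:
  assumes "boxwise_lipschitz P f" "boxwise_lipschitz P g"
  shows "boxwise_lipschitz P (\<lambda>u. f u - g u)"
  using boxwise_lipschitz_add[OF assms(1) boxwise_lipschitz_mult[OF boxwise_lipschitz_const[of P "-1"] assms(2)]]
  by simp

abbreviation coeff_measure :: "'j set \<Rightarrow> ('j \<Rightarrow> real) measure" where
  "coeff_measure J \<equiv> \<Pi>\<^sub>M j\<in>J. (lborel :: real measure)"

lemma null_if_covers:
  assumes "\<And>k::nat. k > 0 \<Longrightarrow> U k \<in> sets M" "\<And>k. k > 0 \<Longrightarrow> Z \<subseteq> U k"
    and "\<And>k. k > 0 \<Longrightarrow> emeasure M (U k) \<le> ennreal (C / k)"
  shows "Z \<in> null_sets (completion M)"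
proof -
  define V where "V = (\<Inter>k\<in>{0<..}. U k)"
  have V: "V \<in> sets M" unfolding V_def using assms(1) by (intro sets.countable_INT') auto
  have "emeasure M V \<le> ennreal (C / real k)" if "k > 0" for k :: nat
    using assms(3)[OF that] emeasure_mono[of V "U k" M] assms(1) that
    by (auto simp: V_def intro: order_trans)
  then have "\<forall>\<^sub>F k in sequentially. emeasure M V \<le> ennreal (C / real k)"
    by (intro eventually_mono[OF eventually_gt_at_top[of "0::nat"]]) auto
  moreover have "(\<lambda>k. ennreal (C / real k)) \<longlonglongrightarrow> ennreal 0"
    by (intro tendsto_ennrealI lim_const_over_n)
  ultimately have "emeasure M V \<le> ennreal 0"
    using tendsto_lowerbound trivial_limit_sequentially by blast
  then have "V \<in> null_sets M" using V by (simp add: null_sets_def)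
  moreover have "Z \<subseteq> V" using assms(2) by (auto simp: V_def)
  ultimately show ?thesis by (metis null_sets_completion_subset null_sets_completionI)
qed

text \<open>
  A locally Lipschitz map does not raise dimension: the parameter box of radius \<open>R\<close> splits into \<open>k\<close>
  cells per side, that is, at most of order \<open>k\<close> to the power \<open>card P\<close> cells, and the image of each lies
  in a box of volume of order \<open>1 / k\<close> to the power \<open>card J\<close>. The total volume is of order \<open>1 / k\<close>.
  Dimensions are cardinalities of index sets here, as they depend on the degrees and on the number of
  polynomials.
\<close>

lemma null_image_of_box:
  fixes J :: "'j set" and P :: "'p set" and \<Phi> :: "'j \<Rightarrow> ('p \<Rightarrow> real) \<Rightarrow> real"
  assumes "finite J" "finite P" "card P < card J" and lip: "\<And>j. j \<in> J \<Longrightarrow> boxwise_lipschitz P (\<Phi> j)"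
    and Z: "Z \<subseteq> extensional J" "\<And>z. z \<in> Z \<Longrightarrow> \<exists>u. (\<forall>p\<in>P. \<bar>u p\<bar> \<le> R) \<and> (\<forall>j\<in>J. z j = \<Phi> j u)"
    and "R \<ge> 0"
  shows "Z \<in> null_sets (completion (coeff_measure J))"
proof -
  interpret product_sigma_finite "\<lambda>_::'j. lborel :: real measure" ..
  have "\<forall>j\<in>J. \<exists>L\<ge>0. \<forall>u v \<delta>. (\<forall>p\<in>P. \<bar>u p\<bar> \<le> R \<and> \<bar>v p\<bar> \<le> R \<and> \<bar>u p - v p\<bar> \<le> \<delta>) \<longrightarrow> 0 \<le> \<delta> \<longrightarrow>
      \<bar>\<Phi> j u - \<Phi> j v\<bar> \<le> L * \<delta>"
    using lip unfolding boxwise_lipschitz_def by metis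
  then obtain l where l: "\<And>j. j \<in> J \<Longrightarrow> l j \<ge> 0"
    "\<And>j u v \<delta>. j \<in> J \<Longrightarrow> (\<forall>p\<in>P. \<bar>u p\<bar> \<le> R \<and> \<bar>v p\<bar> \<le> R \<and> \<bar>u p - v p\<bar> \<le> \<delta>) \<Longrightarrow> 0 \<le> \<delta> \<Longrightarrow>
       \<bar>\<Phi> j u - \<Phi> j v\<bar> \<le> l j * \<delta>"
    by metis
  define L where "L = sum l J"
  have "L \<ge> 0" using l(1) by (auto simp: L_def intro: sum_nonneg)
  have lL: "l j \<le> L" if "j \<in> J" for j
    unfolding L_def using assms(1) that l(1) by (intro member_le_sum) auto
  \<comment> \<open>\<open>c k G\<close> is the lower corner of the cell \<open>G\<close> of side \<open>2 R / k\<close>;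
    the index \<open>k\<close> only serves the right end point.\<close>
  define c where "c k G p = - R + 2 * R * real (G p) / real k" for k :: nat and G :: "'p \<Rightarrow> nat" and p
  define w where "w k = L * (2 * R / real k)" for k :: nat
  define box where "box k G = PiE J (\<lambda>j. {\<Phi> j (c k G) - w k .. \<Phi> j (c k G) + w k})" for k G
  define U where "U k = (\<Union>G\<in>PiE P (\<lambda>_. {..k}). box k G)" for k
  have finG: "finite (PiE P (\<lambda>_. {..k}))" for k :: nat
    using assms(2) by (intro finite_PiE) auto
  have w0: "w k \<ge> 0" for k using \<open>L \<ge> 0\<close> \<open>R \<ge> 0\<close> by (simp add: w_def)
  have meas_box: "box k G \<in> sets (coeff_measure J)" for k G
    unfolding box_def using assms(1) by (intro sets_PiM_I_finite) auto
  have em_box: "emeasure (coeff_measure J) (box k G) = ennreal ((2 * w k) ^ card J)" for k G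
  proof -
    have "emeasure (coeff_measure J) (box k G) = (\<Prod>j\<in>J. ennreal (2 * w k))"
      unfolding box_def using assms(1) w0[of k] by (subst emeasure_PiM) (auto intro!: prod.cong)
    also have "\<dots> = ennreal ((2 * w k) ^ card J)"
      using w0[of k] by (simp add: ennreal_power)
    finally show ?thesis .
  qed
  show ?thesis
  proof (rule null_if_covers[where U = U and C = "2 ^ card P * (4 * L * R) ^ card J"])
    fix k :: nat assume k: "k > 0"
    show "U k \<in> sets (coeff_measure J)"
      unfolding U_def using finG meas_box by (intro sets.finite_UN) auto
    show "Z \<subseteq> U k"
    proof
      fix z assume "z \<in> Z"
      then obtain u where u: "\<forall>p\<in>P. \<bar>u p\<bar> \<le> R" "\<forall>j\<in>J. z j = \<Phi> j u" using Z(2) by blast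
      define G where "G = restrict (\<lambda>p. nat \<lfloor>(u p + R) * k / (2 * R)\<rfloor>) P"
      have GP: "real (G p) \<le> (u p + R) * k / (2 * R)" "(u p + R) * k / (2 * R) \<le> real (G p) + 1"
        if "p \<in> P" for p
      proof -
        have "0 \<le> (u p + R) * k / (2 * R)" using u(1) that \<open>R \<ge> 0\<close> by (force intro!: divide_nonneg_nonneg mult_nonneg_nonneg)
        then show "real (G p) \<le> (u p + R) * k / (2 * R)" "(u p + R) * k / (2 * R) \<le> real (G p) + 1"
          using that by (auto simp: G_def)
      qed
      have Gk: "G p \<le> k" and cR: "\<bar>c k G p\<bar> \<le> R" and close: "\<bar>u p - c k G p\<bar> \<le> 2 * R / k"
        if p: "p \<in> P" for p
      proof -
        have uR: "\<bar>u p\<bar> \<le> R" using u(1) p by auto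
        consider "R = 0" | "R > 0" using \<open>R \<ge> 0\<close> by linarith
        then have "G p \<le> k \<and> \<bar>c k G p\<bar> \<le> R \<and> \<bar>u p - c k G p\<bar> \<le> 2 * R / k"
        proof cases
          case 1 then show ?thesis using uR GP(1)[OF p] by (simp add: c_def)
        next
          case 2
          have "(u p + R) * k \<le> (2 * R) * k" using uR k by (intro mult_right_mono) auto
          then have "(u p + R) * k / (2 * R) \<le> k" using 2 by (simp add: field_simps)
          then have Gk: "real (G p) \<le> k" using GP(1)[OF p] by linarith
          have "2 * R * real (G p) \<le> 2 * R * k" using Gk 2 by (intro mult_left_mono) auto
          then have a: "2 * R * real (G p) / k \<le> 2 * R" using k by (simp add: field_simps)
          have b: "2 * R * real (G p) / k \<le> u p + R" using GP(1)[OF p] 2 k by (simp add: field_simps)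
          have c: "u p + R \<le> 2 * R * real (G p) / k + 2 * R / k" using GP(2)[OF p] 2 k by (simp add: field_simps)
          have "0 \<le> 2 * R * real (G p) / k" using 2 by simp
          then show ?thesis using Gk a b c by (auto simp: c_def)
        qed
        then show "G p \<le> k" "\<bar>c k G p\<bar> \<le> R" "\<bar>u p - c k G p\<bar> \<le> 2 * R / k" by auto
      qed
      have "\<bar>z j - \<Phi> j (c k G)\<bar> \<le> w k" if j: "j \<in> J" for j
      proof -
        have "\<bar>\<Phi> j u - \<Phi> j (c k G)\<bar> \<le> l j * (2 * R / k)"
          using u(1) cR close \<open>R \<ge> 0\<close> by (intro l(2)[OF j]) auto
        also have "\<dots> \<le> w k" unfolding w_def using lL[OF j] \<open>R \<ge> 0\<close> by (intro mult_right_mono) auto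
        finally show ?thesis using u(2) j by simp
      qed
      then have "z \<in> box k G" using Z(1) \<open>z \<in> Z\<close> by (fastforce simp: box_def PiE_def)
      moreover have "G \<in> PiE P (\<lambda>_. {..k})" using Gk by (auto simp: G_def)
      ultimately show "z \<in> U k" by (auto simp: U_def)
    qed
    have "emeasure (coeff_measure J) (U k) \<le> (\<Sum>G\<in>PiE P (\<lambda>_. {..k}). emeasure (coeff_measure J) (box k G))"
      unfolding U_def using finG meas_box by (intro emeasure_subadditive_finite) auto
    also have "\<dots> = of_nat ((k + 1) ^ card P) * ennreal ((2 * w k) ^ card J)"
      using assms(2) by (simp add: em_box card_PiE)
    also have "\<dots> = ennreal (real ((k + 1) ^ card P) * (2 * w k) ^ card J)"
      by (subst ennreal_of_nat_eq_real_of_nat, subst ennreal_mult') (use w0[of k] in auto)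
    also have "\<dots> \<le> ennreal (2 ^ card P * (4 * L * R) ^ card J / k)"
    proof (rule ennreal_leI)
      have "real ((k + 1) ^ card P) \<le> (2 * real k) ^ card P"
        unfolding of_nat_power using k by (intro power_mono) auto
      then have "real ((k + 1) ^ card P) * (2 * w k) ^ card J \<le> (2 * real k) ^ card P * (2 * w k) ^ card J"
        using w0[of k] by (intro mult_right_mono) auto
      also have "\<dots> = 2 ^ card P * (4 * L * R) ^ card J * (real k ^ card P / real k ^ card J)"
        by (simp add: w_def power_mult_distrib power_divide)
      also have "real k ^ card P / real k ^ card J \<le> 1 / k"
      proof -
        have "real k ^ card P * k \<le> real k ^ card J"
          using k assms(3) power_increasing[of "Suc (card P)" "card J" "real k"] by (simp add: mult.commute)
        then show ?thesis using k by (simp add: field_simps)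
      qed
      then have "2 ^ card P * (4 * L * R) ^ card J * (real k ^ card P / real k ^ card J)
          \<le> 2 ^ card P * (4 * L * R) ^ card J * (1 / k)"
        using \<open>L \<ge> 0\<close> \<open>R \<ge> 0\<close> by (intro mult_left_mono) auto
      finally show "real ((k + 1) ^ card P) * (2 * w k) ^ card J \<le> 2 ^ card P * (4 * L * R) ^ card J / k"
        by simp
    qed
    finally show "emeasure (coeff_measure J) (U k) \<le> ennreal (2 ^ card P * (4 * L * R) ^ card J / k)" .
  qed
qed

text \<open>
  The boxes of integer radius exhaust the parameter space.
\<close>

lemma null_image:
  fixes J :: "'j set" and P :: "'p set" and \<Phi> :: "'j \<Rightarrow> ('p \<Rightarrow> real) \<Rightarrow> real"
  assumes "finite J" "finite P" "card P < card J" and lip: "\<And>j. j \<in> J \<Longrightarrow> boxwise_lipschitz P (\<Phi> j)"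
    and Z: "Z \<subseteq> extensional J" "\<And>z. z \<in> Z \<Longrightarrow> \<exists>u. \<forall>j\<in>J. z j = \<Phi> j u"
  shows "Z \<in> null_sets (completion (coeff_measure J))"
proof -
  define Y where "Y R = {z \<in> Z. \<exists>u. (\<forall>p\<in>P. \<bar>u p\<bar> \<le> real R) \<and> (\<forall>j\<in>J. z j = \<Phi> j u)}" for R :: nat
  have "Y R \<in> null_sets (completion (coeff_measure J))" for R
    using assms by (intro null_image_of_box[where R = "real R" and \<Phi> = \<Phi> and P = P]) (auto simp: Y_def)
  then have "(\<Union>R. Y R) \<in> null_sets (completion (coeff_measure J))" by (rule null_sets_UN)
  moreover have "z \<in> (\<Union>R. Y R)" if zZ: "z \<in> Z" for z
  proof -
    obtain u where u: "\<forall>j\<in>J. z j = \<Phi> j u" using Z(2) zZ by blast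
    obtain R :: nat where "(\<Sum>p\<in>P. \<bar>u p\<bar>) \<le> real R" using real_arch_simple by blast
    then have "\<forall>p\<in>P. \<bar>u p\<bar> \<le> real R"
      using assms(2) member_le_sum[of _ P "\<lambda>p. \<bar>u p\<bar>"] by (fastforce intro: order_trans)
    then show ?thesis using u zZ by (auto simp: Y_def)
  qed
  then have "(\<Union>R. Y R) = Z" by (auto simp: Y_def)
  ultimately show ?thesis by simp
qed

lemma null_hyperplane:
  assumes "finite J" "e \<in> J"
  shows "{z \<in> extensional J. z e = (0::real)} \<in> null_sets (completion (coeff_measure J))"
proof (rule null_image[where P = "J - {e}" and \<Phi> = "\<lambda>j u. if j = e then 0 else u j"])
  show "card (J - {e}) < card J" using assms by (rule card_Diff1_less)
  show "boxwise_lipschitz (J - {e}) (\<lambda>u. if j = e then 0 else u j)" if "j \<in> J" for j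
    using that by (cases "j = e") auto
qed (use assms in auto)

text \<open>
  By Fubini: integrating first along the coordinate \<open>e\<close> already gives zero.
\<close>

lemma null_one_point_per_line:
  assumes "finite J" "e \<in> J" "B \<in> sets (coeff_measure J)"
    and one: "\<And>z s t. z(e := s) \<in> B \<Longrightarrow> z(e := t) \<in> B \<Longrightarrow> s = t"
  shows "B \<in> null_sets (coeff_measure J)"
proof -
  interpret product_sigma_finite "\<lambda>_::'a. lborel :: real measure" ..
  define I where "I = J - {e}"
  have J: "insert e I = J" "e \<notin> I" "finite I" using assms(1,2) by (auto simp: I_def)
  have inner: "(\<integral>\<^sup>+ t. indicator B (x(e := t)) \<partial>lborel) = 0" for x
  proof -
    have "{t. x(e := t) \<in> B} \<subseteq> {SOME t. x(e := t) \<in> B}"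
      using one by (auto intro: someI2)
    then have "countable {t. x(e := t) \<in> B}" using countable_subset by blast
    then have "emeasure lborel {t. x(e := t) \<in> B} = 0" "{t. x(e := t) \<in> B} \<in> sets borel"
      by (auto intro: emeasure_lborel_countable sets.countable)
    moreover have "(\<lambda>t. indicator B (x(e := t)) :: ennreal) = indicator {t. x(e := t) \<in> B}"
      by (auto simp: indicator_def)
    ultimately show ?thesis by simp
  qed
  have "emeasure (coeff_measure J) B = (\<integral>\<^sup>+ z. indicator B z \<partial>coeff_measure (insert e I))"
    using assms(3) by (simp add: J)
  also have "\<dots> = (\<integral>\<^sup>+ x. (\<integral>\<^sup>+ t. indicator B (x(e := t)) \<partial>lborel) \<partial>coeff_measure I)"
    using assms(3) J by (intro product_nn_integral_insert) auto
  also have "\<dots> = 0" by (simp add: inner)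
  finally show ?thesis using assms(3) by (simp add: null_sets_def)
qed

section \<open>Forms and homogenization\<close>

abbreviation single where "single \<equiv> Poly_Mapping.single"

definition monomial :: "('n::finite \<Rightarrow>\<^sub>0 nat) \<Rightarrow> real ^ 'n \<Rightarrow> real" where
  "monomial \<alpha> x = (\<Prod>i\<in>UNIV. (x $ i) ^ Poly_Mapping.lookup \<alpha> i)"

definition monomial_partial :: "'n \<Rightarrow> ('n::finite \<Rightarrow>\<^sub>0 nat) \<Rightarrow> real ^ 'n \<Rightarrow> real" where
  "monomial_partial i \<alpha> x =
     real (Poly_Mapping.lookup \<alpha> i) * (x $ i) ^ (Poly_Mapping.lookup \<alpha> i - 1) * (\<Prod>j\<in>UNIV - {i}. (x $ j) ^ Poly_Mapping.lookup \<alpha> j)"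

definition monos_of :: "nat \<Rightarrow> ('n::finite \<Rightarrow>\<^sub>0 nat) set" where
  "monos_of d = {\<alpha>. mono_degree \<alpha> = d}"

definition form :: "nat \<Rightarrow> (('n::finite \<Rightarrow>\<^sub>0 nat) \<Rightarrow> real) \<Rightarrow> real ^ 'n \<Rightarrow> real" where
  "form d c x = (\<Sum>\<alpha>\<in>monos_of d. c \<alpha> * monomial \<alpha> x)"

definition form_partial :: "'n \<Rightarrow> nat \<Rightarrow> (('n::finite \<Rightarrow>\<^sub>0 nat) \<Rightarrow> real) \<Rightarrow> real ^ 'n \<Rightarrow> real" where
  "form_partial i d c x = (\<Sum>\<alpha>\<in>monos_of d. c \<alpha> * monomial_partial i \<alpha> x)"

text \<open>
  With \<open>z = (y, s)\<close> this is \<open>s\<^sup>d q(y / s)\<close>, extended to \<open>s = 0\<close>, for the polynomial \<open>q\<close> with coefficients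
  \<open>c\<close>; the hyperplane \<open>s = 0\<close> represents the directions at infinity.
\<close>

definition homogenized :: "nat \<Rightarrow> (('n::finite \<Rightarrow>\<^sub>0 nat) \<Rightarrow> real) \<Rightarrow> (real ^ 'n) \<times> real \<Rightarrow> real" where
  "homogenized d c z = (\<Sum>\<alpha>\<in>monos_upto d. c \<alpha> * (snd z ^ (d - mono_degree \<alpha>) * monomial \<alpha> (fst z)))"

lemma monos_of_subset: "monos_of d \<subseteq> monos_upto d"
  by (auto simp: monos_of_def monos_upto_def)

lemma finite_monos_of: "finite (monos_of d)"
  using finite_subset[OF monos_of_subset finite_monos_upto] .

lemma mono_degree_single: "mono_degree (Poly_Mapping.single k d) = d"
  by (simp add: mono_degree_def lookup_single when_def)

lemma single_mem_monos_of: "single k d \<in> monos_of d"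
  by (simp add: monos_of_def mono_degree_single)

lemma monomial_single: "monomial (single k d) x = (x $ k) ^ d"
proof -
  have "monomial (single k d) x = (\<Prod>i\<in>UNIV. if i = k then (x $ k) ^ d else 1)"
    unfolding monomial_def by (intro prod.cong) (auto simp: lookup_single when_def)
  then show ?thesis by simp
qed

lemma monomial_scaleR: "monomial \<alpha> (t *\<^sub>R x) = t ^ mono_degree \<alpha> * monomial \<alpha> x"
  by (simp add: monomial_def mono_degree_def power_mult_distrib prod.distrib power_sum)

lemma form_scaleR: "form d c (t *\<^sub>R x) = t ^ d * form d c x"
  unfolding form_def sum_distrib_left
  by (intro sum.cong) (auto simp: monomial_scaleR monos_of_def)

lemma form_cong: "(\<And>\<alpha>. \<alpha> \<in> monos_of d \<Longrightarrow> c \<alpha> = c' \<alpha>) \<Longrightarrow> form d c x = form d c' x"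
  unfolding form_def by (intro sum.cong) auto

lemma form_partial_cong:
  "(\<And>\<alpha>. \<alpha> \<in> monos_of d \<Longrightarrow> c \<alpha> = c' \<alpha>) \<Longrightarrow> form_partial i d c x = form_partial i d c' x"
  unfolding form_partial_def by (intro sum.cong) auto

text \<open>
  The pure power \<open>x\<^sub>k\<^sup>d\<close> is a coordinate direction in coefficient space that moves the value at every
  point with \<open>x\<^sub>k \<noteq> 0\<close>.
\<close>

lemma form_upd_single:
  "form d (z(single k d := t)) x = form d z x + (t - z (single k d)) * (x $ k) ^ d"
proof -
  have "form d (z(single k d := t)) x =
      (\<Sum>\<alpha>\<in>monos_of d. z \<alpha> * monomial \<alpha> x + (if \<alpha> = single k d then (t - z \<alpha>) * monomial \<alpha> x else 0))"
    unfolding form_def by (intro sum.cong) (auto simp: algebra_simps)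
  also have "\<dots> = form d z x + (t - z (single k d)) * (x $ k) ^ d"
    by (simp add: sum.distrib form_def finite_monos_of single_mem_monos_of monomial_single)
  finally show ?thesis .
qed

lemma homogenized_at_infinity: "homogenized d c (x, 0) = form d c x"
proof -
  have "homogenized d c (x, 0) = (\<Sum>\<alpha>\<in>monos_of d. c \<alpha> * (0 ^ (d - mono_degree \<alpha>) * monomial \<alpha> x))"
    unfolding homogenized_def fst_conv snd_conv
    by (rule sum.mono_neutral_right[OF finite_monos_upto monos_of_subset])
       (auto simp: monos_of_def monos_upto_def)
  then show ?thesis by (simp add: form_def monos_of_def)
qed

lemma peval_eq_homogenized:
  assumes "q \<in> polys_upto d" "t > 0"
  shows "peval q (t *\<^sub>R x) = t ^ d * homogenized d (Poly_Mapping.lookup q) (x, 1 / t)"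
proof -
  have "peval q (t *\<^sub>R x) = (\<Sum>\<alpha>\<in>monos_upto d. Poly_Mapping.lookup q \<alpha> * monomial \<alpha> (t *\<^sub>R x))"
    unfolding peval_def monomial_def[symmetric]
    using assms(1) by (intro sum.mono_neutral_left[OF finite_monos_upto]) (auto simp: polys_upto_def in_keys_iff)
  also have "\<dots> = t ^ d * homogenized d (Poly_Mapping.lookup q) (x, 1 / t)"
    unfolding homogenized_def sum_distrib_left
  proof (intro sum.cong refl)
    fix \<alpha> :: "'a \<Rightarrow>\<^sub>0 nat" assume "\<alpha> \<in> monos_upto d"
    then have "t ^ d = t ^ mono_degree \<alpha> * t ^ (d - mono_degree \<alpha>)"
      by (simp add: monos_upto_def flip: power_add)
    then show "Poly_Mapping.lookup q \<alpha> * monomial \<alpha> (t *\<^sub>R x) =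
        t ^ d * (Poly_Mapping.lookup q \<alpha> * (snd (x, 1 / t) ^ (d - mono_degree \<alpha>) * monomial \<alpha> (fst (x, 1 / t))))"
      using assms(2) by (simp add: monomial_scaleR power_divide)
  qed
  finally show ?thesis .
qed

lemma lookup_hom_component:
  "Poly_Mapping.lookup (hom_component k q) \<alpha> = (if mono_degree \<alpha> = k then Poly_Mapping.lookup q \<alpha> else 0)"
proof -
  have "Poly_Mapping.lookup (hom_component k q) \<alpha> =
      (\<Sum>\<beta>\<in>{\<beta> \<in> Poly_Mapping.keys q. mono_degree \<beta> = k}. if \<beta> = \<alpha> then Poly_Mapping.lookup q \<beta> else 0)"
    unfolding hom_component_def lookup_sum by (intro sum.cong) (auto simp: lookup_single when_def)
  then show ?thesis by (auto simp: sum.delta in_keys_iff)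
qed

lemma peval_hom_component: "peval (hom_component d q) x = form d (Poly_Mapping.lookup q) x"
proof -
  have "peval (hom_component d q) x = (\<Sum>\<alpha>\<in>monos_of d. Poly_Mapping.lookup (hom_component d q) \<alpha> * monomial \<alpha> x)"
    unfolding peval_def monomial_def[symmetric]
    by (intro sum.mono_neutral_left[OF finite_monos_of])
       (auto simp: in_keys_iff lookup_hom_component monos_of_def split: if_splits)
  then show ?thesis by (simp add: form_def lookup_hom_component monos_of_def)
qed

lemma highest_component_eq:
  assumes "q \<in> polys_upto d" "Poly_Mapping.lookup q (Poly_Mapping.single k d) \<noteq> 0"
  shows "highest_component q = hom_component d q"
proof -
  have "Poly_Mapping.single k d \<in> Poly_Mapping.keys q" using assms(2) by (simp add: in_keys_iff)
  then have "d \<in> mono_degree ` Poly_Mapping.keys q" by (metis image_eqI mono_degree_single)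
  moreover have "\<forall>e\<in>mono_degree ` Poly_Mapping.keys q. e \<le> d"
    using assms(1) by (auto simp: polys_upto_def monos_upto_def)
  ultimately have "total_degree q = d"
    unfolding total_degree_def by (intro Max_eqI) auto
  then show ?thesis by (simp add: highest_component_def)
qed

lemma continuous_on_homogenized [continuous_intros]:
  "continuous_on S (homogenized d c)"
  unfolding homogenized_def[abs_def] monomial_def by (intro continuous_intros)

lemma continuous_on_form [continuous_intros]: "continuous_on S (form d c)"
  unfolding form_def[abs_def] monomial_def by (intro continuous_intros)

lemma monomial_has_derivative:
  "(monomial \<alpha> has_derivative (\<lambda>w. \<Sum>i\<in>UNIV. monomial_partial i \<alpha> x * w $ i)) (at x)"
proof -
  have "((\<lambda>x. \<Prod>i\<in>UNIV. (x $ i) ^ Poly_Mapping.lookup \<alpha> i) has_derivative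
     (\<lambda>w. \<Sum>i\<in>UNIV. (of_nat (Poly_Mapping.lookup \<alpha> i) * (w $ i) * (x $ i) ^ (Poly_Mapping.lookup \<alpha> i - 1)) *
        (\<Prod>j\<in>UNIV - {i}. (x $ j) ^ Poly_Mapping.lookup \<alpha> j))) (at x)"
    by (intro has_derivative_prod has_derivative_power bounded_linear.has_derivative[OF bounded_linear_vec_nth] has_derivative_ident)
  then show ?thesis
    unfolding monomial_def[abs_def] monomial_partial_def by (simp add: mult_ac)
qed

text \<open>
  Only the derivative along the hyperplane at infinity matters, and it is that of the form of
  degree \<open>d\<close>.
\<close>

lemma homogenized_has_derivative:
  "\<exists>D. (homogenized d c has_derivative D) (at (x, 0)) \<and>
       (\<forall>w. D (w, 0) = (\<Sum>i\<in>UNIV. form_partial i d c x * w $ i))"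
proof -
  define P where "P \<alpha> w = (\<Sum>i\<in>UNIV. monomial_partial i \<alpha> x * w $ i)" for \<alpha> and w :: "real ^ 'a"
  define D where "D w = (\<Sum>\<alpha>\<in>monos_upto d. c \<alpha> * (0 ^ (d - mono_degree \<alpha>) * P \<alpha> (fst w) +
      (of_nat (d - mono_degree \<alpha>) * snd w * 0 ^ (d - mono_degree \<alpha> - 1)) * monomial \<alpha> x))" for w :: "(real ^ 'a) \<times> real"
  have mon: "((\<lambda>z. monomial \<alpha> (fst z)) has_derivative (\<lambda>w. P \<alpha> (fst w))) (at (x, 0::real))" for \<alpha>
    unfolding P_def
    by (rule has_derivative_compose[OF has_derivative_fst[OF has_derivative_ident] monomial_has_derivative, of _ "(x, 0)", simplified])
  have pow: "((\<lambda>z. snd z ^ k) has_derivative (\<lambda>w. of_nat k * snd w * 0 ^ (k - 1))) (at (x, 0::real))" for k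
    using has_derivative_power[OF has_derivative_snd[OF has_derivative_ident], where x = "(x, 0::real)" and S = UNIV and n = k] by simp
  have product: "((\<lambda>z. snd z ^ k * monomial \<alpha> (fst z)) has_derivative
      (\<lambda>w. 0 ^ k * P \<alpha> (fst w) + (of_nat k * snd w * 0 ^ (k - 1)) * monomial \<alpha> x)) (at (x, 0::real))" for k \<alpha>
    using has_derivative_mult[OF pow mon] by simp
  have "(homogenized d c has_derivative D) (at (x, 0))"
    unfolding homogenized_def[abs_def] D_def by (intro has_derivative_sum has_derivative_mult_right product)
  moreover have "D (w, 0) = (\<Sum>i\<in>UNIV. form_partial i d c x * w $ i)" for w
  proof -
    have "D (w, 0) = (\<Sum>\<alpha>\<in>monos_of d. c \<alpha> * (0 ^ (d - mono_degree \<alpha>) * P \<alpha> w))"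
      unfolding D_def
      by (simp, rule sum.mono_neutral_right[OF finite_monos_upto monos_of_subset])
         (auto simp: monos_of_def monos_upto_def)
    also have "\<dots> = (\<Sum>\<alpha>\<in>monos_of d. c \<alpha> * P \<alpha> w)" by (simp add: monos_of_def)
    also have "\<dots> = (\<Sum>i\<in>UNIV. form_partial i d c x * w $ i)"
      unfolding P_def form_partial_def sum_distrib_left sum_distrib_right
      by (subst sum.swap) (simp add: mult_ac)
    finally show ?thesis .
  qed
  ultimately show ?thesis by blast
qed

section \<open>Nonnegative forms with a zero\<close>

text \<open>
  Increasing the coefficient of \<open>x\<^sub>k\<^sup>d\<close>, with the sign \<open>s\<close>, makes a form that is nonnegative on \<open>X\<close>
  dominate a positive multiple of \<open>s x\<^sub>k\<^sup>d\<close> there, which excludes zeros. So a line in this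
  direction carries at most one such form that has a zero on \<open>X\<close>. Testing the inequalities on a
  countable dense subset of \<open>X\<close> gives measurability.
\<close>

lemma null_touching_forms:
  fixes X :: "(real ^ 'n::finite) set" and s :: real
  assumes s: "s * s = 1" and pos: "\<And>x. x \<in> X \<Longrightarrow> s * (x $ k) ^ d > 0"
  shows "{z \<in> extensional (monos_upto d). (\<forall>x\<in>X. form d z x \<ge> 0) \<and> (\<exists>x\<in>X. form d z x = 0)}
    \<in> null_sets (completion (coeff_measure (monos_upto d)))" (is "?Z \<in> _")
proof -
  define e where "e = single k d"
  have eJ: "e \<in> monos_upto d" using monos_of_subset single_mem_monos_of by (auto simp: e_def)
  obtain T where T: "countable T" "T \<subseteq> X" "X \<subseteq> closure T" by (rule separable)
  define C where "C c = {z \<in> space (coeff_measure (monos_upto d)).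
      \<forall>x\<in>X. form d z x \<ge> c * (s * (x $ k) ^ d)}" for c
  have C_T: "C c = {z \<in> space (coeff_measure (monos_upto d)). \<forall>x\<in>T. form d z x \<ge> c * (s * (x $ k) ^ d)}" for c
  proof -
    have "form d z x \<ge> c * (s * (x $ k) ^ d)" if *: "\<forall>x\<in>T. form d z x \<ge> c * (s * (x $ k) ^ d)" "x \<in> X" for z x
    proof -
      have "closed {x. c * (s * (x $ k) ^ d) \<le> form d z x}"
        by (intro closed_Collect_le continuous_intros)
      moreover have "T \<subseteq> {x. c * (s * (x $ k) ^ d) \<le> form d z x}" using *(1) by auto
      ultimately have "closure T \<subseteq> {x. c * (s * (x $ k) ^ d) \<le> form d z x}" by (rule closure_minimal[rotated])
      then show ?thesis using *(2) T(3) by auto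
    qed
    then show ?thesis using T(2) by (auto simp: C_def)
  qed
  have meas_form: "(\<lambda>z. form d z x) \<in> borel_measurable (coeff_measure (monos_upto d))" for x
    unfolding form_def
    by (intro borel_measurable_sum borel_measurable_times borel_measurable_const)
       (use measurable_component_singleton[of _ "monos_upto d" "\<lambda>_. lborel :: real measure"] monos_of_subset in auto)
  have meas_C: "C c \<in> sets (coeff_measure (monos_upto d))" for c
    unfolding C_T using T(1) meas_form by measurable
  \<comment> \<open>The forms whose nonnegativity on \<open>X\<close> is lost when the coefficient of \<open>x\<^sub>k\<^sup>d\<close> is lowered
    by any fixed amount; nonnegative forms with a zero on \<open>X\<close> are among them.\<close>
  define B where "B = C 0 - (\<Union>n. C (1 / real (Suc n)))"
  have "B \<in> null_sets (coeff_measure (monos_upto d))"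
  proof (rule null_one_point_per_line[OF finite_monos_upto eJ])
    show "B \<in> sets (coeff_measure (monos_upto d))" unfolding B_def using meas_C by auto
    have up: "\<not> 0 < s * (b - a)" if z: "z(e := a) \<in> B" "z(e := b) \<in> B" for z a b
    proof
      assume less: "0 < s * (b - a)"
      obtain n where n: "1 / real (Suc n) \<le> s * (b - a)"
        using reals_Archimedean[OF less] by (auto simp: inverse_eq_divide intro: less_imp_le)
      have "form d (z(e := b)) x \<ge> 1 / real (Suc n) * (s * (x $ k) ^ d)" if x: "x \<in> X" for x
      proof -
        have "form d (z(e := b)) x = form d (z(e := a)) x + (b - a) * (x $ k) ^ d"
          using form_upd_single[of d "z(e := a)" k b x] by (simp add: e_def)
        also have "(b - a) * (x $ k) ^ d = (s * (b - a)) * (s * (x $ k) ^ d)"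
        proof -
          have "(s * (b - a)) * (s * (x $ k) ^ d) = (s * s) * ((b - a) * (x $ k) ^ d)" by (simp only: mult_ac)
          then show ?thesis using s by simp
        qed
        finally have "form d (z(e := b)) x = form d (z(e := a)) x + (s * (b - a)) * (s * (x $ k) ^ d)" .
        moreover have "form d (z(e := a)) x \<ge> 0" using z(1) x by (auto simp: B_def C_def)
        moreover have "1 / real (Suc n) * (s * (x $ k) ^ d) \<le> (s * (b - a)) * (s * (x $ k) ^ d)"
          using n pos[OF x] by (intro mult_right_mono) auto
        ultimately show ?thesis by linarith
      qed
      then have "z(e := b) \<in> C (1 / real (Suc n))" using z(2) by (auto simp: C_def B_def)
      then show False using z(2) by (auto simp: B_def)
    qed
    show "a = b" if z: "z(e := a) \<in> B" "z(e := b) \<in> B" for z a b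
    proof (rule ccontr)
      assume "a \<noteq> b"
      moreover have "s \<noteq> 0" using s by auto
      ultimately have "s * (b - a) \<noteq> 0" by auto
      moreover have "s * (a - b) = - (s * (b - a))" by (simp add: algebra_simps)
      ultimately show False using up[OF z] up[OF z(2,1)] by linarith
    qed
  qed
  moreover have "?Z \<subseteq> B"
  proof
    fix z assume z: "z \<in> ?Z"
    then obtain x where x: "x \<in> X" "form d z x = 0" by auto
    have "z \<notin> C (1 / real (Suc n))" for n
      using x pos[OF x(1)] by (auto simp: C_def not_le intro!: bexI[of _ x])
    then show "z \<in> B" using z by (auto simp: B_def C_def space_PiM PiE_def)
  qed
  ultimately show ?thesis by (rule null_sets_completion_subset[OF _ null_sets_completionI, rotated])
qed

section \<open>Directions at infinity\<close>

text \<open>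
  A weak implicit function theorem for an arbitrary finite number of equations, where independence of
  the derivatives is given by dual vectors \<open>v\<^sub>c\<close>. To avoid a target space whose dimension is the number
  of equations, the equations are encoded in a self-map of the product space,
  \<open>G(y, s) = (y + \<Sum>\<^sub>c (F\<^sub>c(y, s) - D\<^sub>c(y, 0)) v\<^sub>c, s)\<close>. Its derivative at \<open>(x, 0)\<close> is the identity
  up to a shear in the direction of \<open>s\<close>, hence invertible, and \<open>D\<^sub>b\<close> applied to the first component
  of \<open>G(y, s)\<close> gives back \<open>F\<^sub>b(y, s)\<close>. The open mapping theorem for maps with a surjective derivative
  at one point then gives the solutions.
\<close>

lemma solutions_persist:
  fixes F :: "'c \<Rightarrow> 'a::euclidean_space \<times> real \<Rightarrow> real"
  assumes "finite A"
    and F0: "\<And>c. c \<in> A \<Longrightarrow> F c (x, 0) = 0"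
    and cont: "\<And>c. c \<in> A \<Longrightarrow> continuous_on UNIV (F c)"
    and der: "\<And>c. c \<in> A \<Longrightarrow> (F c has_derivative D c) (at (x, 0))"
    and dual: "\<And>c. c \<in> A \<Longrightarrow> \<exists>v. \<forall>b\<in>A. D b (v, 0) = (if b = c then 1 else 0)"
    and T: "open T" "(x, 0) \<in> T"
  obtains s0 where "s0 > 0" "\<And>s. \<bar>s\<bar> < s0 \<Longrightarrow> \<exists>y. (y, s) \<in> T \<and> (\<forall>c\<in>A. F c (y, s) = 0)"
proof -
  obtain v where v: "\<And>b c. b \<in> A \<Longrightarrow> c \<in> A \<Longrightarrow> D b (v c, 0) = (if b = c then 1 else 0)"
    using dual by metis
  have bl: "bounded_linear (D c)" if "c \<in> A" for c
    using der[OF that] has_derivative_bounded_linear by blast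
  have lin: "linear (D c)" if "c \<in> A" for c
    using bl[OF that] bounded_linear.linear by blast
  define G where "G z = (fst z + (\<Sum>c\<in>A. (F c z - D c (fst z, 0)) *\<^sub>R v c), snd z)" for z
  define G' where "G' w = (fst w + (\<Sum>c\<in>A. (D c w - D c (fst w, 0)) *\<^sub>R v c), snd w)" for w
  \<comment> \<open>A right inverse of the derivative \<open>G'\<close>, undoing the shear.\<close>
  define H where "H w = (fst w - (\<Sum>c\<in>A. D c (0, snd w) *\<^sub>R v c), snd w)" for w
  have D0: "bounded_linear (\<lambda>w. D c (fst w, 0))" if "c \<in> A" for c
    using bounded_linear_compose[OF bl[OF that], of "\<lambda>w. (fst w, 0)"]
    by (simp add: bounded_linear_Pair bounded_linear_fst bounded_linear_zero)
  have D1: "bounded_linear (\<lambda>w. D c (0, snd w))" if "c \<in> A" for c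
    using bounded_linear_compose[OF bl[OF that], of "\<lambda>w. (0, snd w)"]
    by (simp add: bounded_linear_Pair bounded_linear_snd bounded_linear_zero)
  have "continuous_on UNIV G"
    unfolding G_def
    by (intro continuous_intros cont linear_continuous_on D0) auto
  moreover have "(G has_derivative G') (at (x, 0))"
    unfolding G_def G'_def
    by (intro has_derivative_Pair has_derivative_add has_derivative_fst has_derivative_snd has_derivative_ident
        has_derivative_sum has_derivative_scaleR_left has_derivative_diff der bounded_linear_imp_has_derivative D0)
  moreover have "bounded_linear H"
    unfolding H_def
    by (intro bounded_linear_Pair bounded_linear_sub bounded_linear_sum bounded_linear_fst bounded_linear_snd
        bounded_linear_scaleR_const D1)
  moreover have "G' \<circ> H = id"
  proof
    fix w :: "'a \<times> real"
    have split: "D c z - D c (fst z, 0) = D c (0, snd z)" if "c \<in> A" for c z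
      using linear_diff[OF lin[OF that], of z "(fst z, 0)"] by (simp add: minus_prod_def)
    have "(\<Sum>c\<in>A. (D c (H w) - D c (fst (H w), 0)) *\<^sub>R v c) = (\<Sum>c\<in>A. D c (0, snd w) *\<^sub>R v c)"
      by (intro sum.cong) (simp_all add: split, simp add: H_def)
    then show "(G' \<circ> H) w = id w" by (simp add: G'_def) (simp add: H_def)
  qed
  ultimately have "G (x, 0) \<in> interior (G ` T)"
    using T by (intro sussmann_open_mapping[where S = UNIV]) (auto simp: interior_open)
  then obtain e where e: "e > 0" "ball (G (x, 0)) e \<subseteq> G ` T"
    by (auto simp: mem_interior)
  show ?thesis
  proof (rule that[OF e(1)])
    fix s :: real assume s: "\<bar>s\<bar> < e"
    have "(fst (G (x, 0)), s) \<in> ball (G (x, 0)) e"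
      using s by (simp add: G_def dist_Pair_Pair dist_real_def)
    then obtain z where z: "z \<in> T" "G z = (fst (G (x, 0)), s)" using e(2) by fastforce
    then have sz: "snd z = s" by (simp add: G_def)
    have *: "D b (fst (G z'), 0) = F b z'" if b: "b \<in> A" for b z'
    proof -
      have "D b (fst (G z'), 0) = D b ((fst z', 0) + (\<Sum>c\<in>A. (F c z' - D c (fst z', 0)) *\<^sub>R (v c, 0)))"
      proof -
        have "(fst (G z'), 0) = (fst z', 0) + (\<Sum>c\<in>A. (F c z' - D c (fst z', 0)) *\<^sub>R (v c, 0 :: real))"
          by (rule prod_eqI) (simp_all add: G_def fst_sum snd_sum)
        then show ?thesis by simp
      qed
      also have "\<dots> = D b (fst z', 0) + (\<Sum>c\<in>A. (F c z' - D c (fst z', 0)) *\<^sub>R D b (v c, 0))"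
        by (simp add: linear_add[OF lin[OF b]] linear_sum[OF lin[OF b]] linear_cmul[OF lin[OF b]] del: scaleR_Pair real_scaleR_def)
      also have "(\<Sum>c\<in>A. (F c z' - D c (fst z', 0)) *\<^sub>R D b (v c, 0)) = (\<Sum>c\<in>A. if c = b then F c z' - D c (fst z', 0) else 0)"
        using b by (intro sum.cong) (auto simp: v)
      finally show ?thesis using b assms(1) by simp
    qed
    have "F c z = 0" if "c \<in> A" for c
      using *[OF that, of z] *[OF that, of "(x, 0)"] z(2) F0[OF that] by simp
    then show "\<exists>y. (y, s) \<in> T \<and> (\<forall>c\<in>A. F c (y, s) = 0)"
      using z(1) sz by (metis prod.collapse)
  qed
qed

text \<open>
  The component of \<open>G l\<close> orthogonal to the span of the other vectors is nonzero; rescale it.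
\<close>

lemma dual_vector:
  fixes G :: "'c \<Rightarrow> 'a::euclidean_space"
  assumes "finite A" "l \<in> A" and indep: "\<nexists>\<mu>. G l = (\<Sum>c\<in>A - {l}. \<mu> c *\<^sub>R G c)"
  shows "\<exists>v. \<forall>b\<in>A. G b \<bullet> v = (if b = l then 1 else 0)"
proof -
  define W where "W = range (\<lambda>\<mu>. \<Sum>c\<in>A - {l}. \<mu> c *\<^sub>R G c)"
  have "subspace W"
    unfolding subspace_def
  proof (intro conjI ballI allI)
    show "0 \<in> W" unfolding W_def by (rule range_eqI[of _ _ "\<lambda>_. 0"]) simp
    show "y + z \<in> W" if yz: "y \<in> W" "z \<in> W" for y z
    proof -
      obtain a b where "y = (\<Sum>c\<in>A - {l}. a c *\<^sub>R G c)" "z = (\<Sum>c\<in>A - {l}. b c *\<^sub>R G c)"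
        using yz by (auto simp: W_def)
      then show ?thesis
        unfolding W_def by (intro range_eqI[of _ _ "\<lambda>c. a c + b c"]) (simp add: scaleR_add_left sum.distrib)
    qed
    show "t *\<^sub>R y \<in> W" if y: "y \<in> W" for t y
    proof -
      obtain a where "y = (\<Sum>c\<in>A - {l}. a c *\<^sub>R G c)" using y by (auto simp: W_def)
      then show ?thesis
        unfolding W_def by (intro range_eqI[of _ _ "\<lambda>c. t * a c"]) (simp add: scaleR_sum_right)
    qed
  qed
  then have span: "span W = W" by (simp add: span_eq_iff)
  obtain y z where yz: "y \<in> W" "\<And>w. w \<in> W \<Longrightarrow> orthogonal z w" "G l = y + z"
    using orthogonal_subspace_decomp_exists[of W "G l"] unfolding span by metis
  have "G l \<notin> W" using indep by (auto simp: W_def)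
  then have "z \<noteq> 0" using yz by auto
  have GW: "G c \<in> W" if "c \<in> A - {l}" for c
  proof -
    have "(\<Sum>b\<in>A - {l}. (if b = c then 1 else 0) *\<^sub>R G b) = (\<Sum>b\<in>A - {l}. if b = c then G b else 0)"
      by (intro sum.cong) auto
    also have "\<dots> = G c" using that assms(1) by simp
    finally show ?thesis unfolding W_def by (intro range_eqI[of _ _ "\<lambda>b. if b = c then 1 else 0"]) (rule sym)
  qed
  show ?thesis
  proof (intro exI ballI)
    fix b assume b: "b \<in> A"
    show "G b \<bullet> (z /\<^sub>R (z \<bullet> z)) = (if b = l then 1 else 0)"
    proof (cases "b = l")
      case True
      have "y \<bullet> z = 0" using yz by (simp add: orthogonal_def inner_commute)
      then show ?thesis using True yz(3) \<open>z \<noteq> 0\<close> by (simp add: inner_add_left)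
    next
      case False
      then show ?thesis using yz(2)[OF GW[of b]] b by (simp add: orthogonal_def inner_commute)
    qed
  qed
qed

text \<open>
  \<open>A\<close> and \<open>B\<close> index the constraints that are active and inactive at \<open>x\<close>. All active constraints,
  inequalities included, are kept equal to zero while the point moves to infinity in directions
  close to \<open>x\<close>. Independence is required of the gradients without their \<open>k\<close>-th entry, which is the
  form in which it is shown to be generic.
\<close>

lemma form_nonneg_at_regular_direction:
  fixes f :: "'c \<Rightarrow> 'n::finite mpoly" and D :: "'c \<Rightarrow> nat" and x :: "real ^ 'n"
  assumes fin: "finite A" "finite B"
    and f: "\<And>c. c \<in> A \<union> B \<Longrightarrow> f c \<in> polys_upto (D c)"
    and A: "\<And>c. c \<in> A \<Longrightarrow> form (D c) (Poly_Mapping.lookup (f c)) x = 0"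
    and B: "\<And>c. c \<in> B \<Longrightarrow> form (D c) (Poly_Mapping.lookup (f c)) x > 0"
    and indep: "\<And>l. l \<in> A \<Longrightarrow> \<nexists>\<mu>. \<forall>i. i \<noteq> k \<longrightarrow> form_partial i (D l) (Poly_Mapping.lookup (f l)) x =
        (\<Sum>c\<in>A - {l}. \<mu> c * form_partial i (D c) (Poly_Mapping.lookup (f c)) x)"
    and p: "p \<in> polys_upto d" "d > 0"
    and bdd: "bdd_below (peval p ` {y. (\<forall>c\<in>A. peval (f c) y = 0) \<and> (\<forall>c\<in>B. peval (f c) y \<ge> 0)})"
  shows "form d (Poly_Mapping.lookup p) x \<ge> 0"
proof (rule ccontr)
  define F where "F c = homogenized (D c) (Poly_Mapping.lookup (f c))" for c
  define Fp where "Fp = homogenized d (Poly_Mapping.lookup p)"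
  define \<nu> where "\<nu> = form d (Poly_Mapping.lookup p) x"
  assume "\<not> form d (Poly_Mapping.lookup p) x \<ge> 0"
  then have "\<nu> < 0" by (simp add: \<nu>_def)
  have "\<forall>c. \<exists>E. (F c has_derivative E) (at (x, 0)) \<and>
      (\<forall>w. E (w, 0) = (\<Sum>i\<in>UNIV. form_partial i (D c) (Poly_Mapping.lookup (f c)) x * w $ i))"
    unfolding F_def using homogenized_has_derivative by blast
  then obtain E where E: "\<And>c. (F c has_derivative E c) (at (x, 0))"
    "\<And>c w. E c (w, 0) = (\<Sum>i\<in>UNIV. form_partial i (D c) (Poly_Mapping.lookup (f c)) x * w $ i)"
    by metis
  have dual: "\<exists>v. \<forall>b\<in>A. E b (v, 0) = (if b = l then 1 else 0)" if l: "l \<in> A" for l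
  proof -
    define G :: "'c \<Rightarrow> real ^ 'n" where
      "G c = (\<chi> i. if i = k then 0 else form_partial i (D c) (Poly_Mapping.lookup (f c)) x)" for c
    have "\<nexists>\<mu>. G l = (\<Sum>c\<in>A - {l}. \<mu> c *\<^sub>R G c)"
    proof
      assume "\<exists>\<mu>. G l = (\<Sum>c\<in>A - {l}. \<mu> c *\<^sub>R G c)"
      then obtain \<mu> where "G l = (\<Sum>c\<in>A - {l}. \<mu> c *\<^sub>R G c)" by blast
      then have eq: "G l $ i = (\<Sum>c\<in>A - {l}. \<mu> c * G c $ i)" for i by (simp add: sum_component)
      have "form_partial i (D l) (Poly_Mapping.lookup (f l)) x =
        (\<Sum>c\<in>A - {l}. \<mu> c * form_partial i (D c) (Poly_Mapping.lookup (f c)) x)" if "i \<noteq> k" for i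
        using eq[of i] that by (simp add: G_def)
      then show False using indep[OF l] by blast
    qed
    then obtain v where v: "\<forall>b\<in>A. G b \<bullet> v = (if b = l then 1 else 0)"
      using dual_vector[OF fin(1) l] by blast
    define v' :: "real ^ 'n" where "v' = (\<chi> i. if i = k then 0 else v $ i)"
    have "E b (v', 0) = G b \<bullet> v" for b
      unfolding E(2) inner_vec_def by (intro sum.cong) (auto simp: v'_def G_def)
    then show ?thesis using v by (intro exI[of _ v']) simp
  qed
  define T where "T = {z. Fp z < \<nu> / 2} \<inter> (\<Inter>c\<in>B. {z. 0 < F c z})"
  have openT: "open T"
    unfolding T_def F_def Fp_def using fin(2)
    by (intro open_Int open_INT ballI open_Collect_less continuous_intros)
  have xT: "(x, 0) \<in> T"
    using B \<open>\<nu> < 0\<close> by (auto simp: T_def F_def Fp_def homogenized_at_infinity \<nu>_def)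
  have zero: "F c (x, 0) = 0" if "c \<in> A" for c
    using A[OF that] by (simp add: F_def homogenized_at_infinity)
  have cont: "continuous_on UNIV (F c)" for c
    unfolding F_def by (rule continuous_on_homogenized)
  obtain s0 where s0: "s0 > 0"
    "\<And>s. \<bar>s\<bar> < s0 \<Longrightarrow> \<exists>y. (y, s) \<in> T \<and> (\<forall>c\<in>A. F c (y, s) = 0)"
    using solutions_persist[OF fin(1) zero cont E(1) dual openT xT] by blast
  obtain M where M: "\<And>y. (\<forall>c\<in>A. peval (f c) y = 0) \<Longrightarrow> (\<forall>c\<in>B. peval (f c) y \<ge> 0) \<Longrightarrow> M \<le> peval p y"
    using bdd by (auto simp: bdd_below_def)
  define t where "t = 1 + 1 / s0 + \<bar>M\<bar> * 2 / (- \<nu>)"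
  have parts: "0 < 1 / s0" "0 \<le> \<bar>M\<bar> * 2 / (- \<nu>)"
    using s0(1) \<open>\<nu> < 0\<close> by (simp, intro divide_nonneg_pos) auto
  have t: "t \<ge> 1" "t > 1 / s0" "t > \<bar>M\<bar> * 2 / (- \<nu>)" using parts unfolding t_def by linarith+
  have "\<bar>1 / t\<bar> < s0" using t(1,2) s0(1) by (simp add: field_simps)
  then obtain y where y: "(y, 1 / t) \<in> T" "\<forall>c\<in>A. F c (y, 1 / t) = 0" using s0(2) by blast
  have ev: "peval (f c) (t *\<^sub>R y) = t ^ D c * F c (y, 1 / t)" if "c \<in> A \<union> B" for c
    unfolding F_def using f[OF that] t(1) by (intro peval_eq_homogenized) auto
  have "M \<le> peval p (t *\<^sub>R y)"
    using y t(1) by (intro M) (auto simp: ev T_def intro!: mult_nonneg_nonneg less_imp_le)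
  also have "\<dots> = t ^ d * Fp (y, 1 / t)"
    unfolding Fp_def using p(1) t(1) by (intro peval_eq_homogenized) auto
  also have "\<dots> \<le> t ^ d * (\<nu> / 2)"
    using y(1) t(1) by (intro mult_left_mono) (auto simp: T_def)
  also have "\<dots> \<le> t * (\<nu> / 2)"
    using \<open>\<nu> < 0\<close> t(1) p(2) self_le_power[of t d] by (intro mult_right_mono_neg) auto
  also have "\<dots> < - \<bar>M\<bar>"
    using t(3) \<open>\<nu> < 0\<close> by (simp add: field_simps)
  finally show False by linarith
qed

section \<open>Genericity of independent gradients\<close>

lemma boxwise_lipschitz_form:
  assumes "\<And>\<alpha>. \<alpha> \<in> monos_of d \<Longrightarrow> boxwise_lipschitz P (\<lambda>u. w u \<alpha>)"
    and "\<And>i. boxwise_lipschitz P (\<lambda>u. X u $ i)"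
  shows "boxwise_lipschitz P (\<lambda>u. form d (w u) (X u))"
    "boxwise_lipschitz P (\<lambda>u. form_partial i d (w u) (X u))"
  unfolding form_def form_partial_def monomial_def monomial_partial_def
  by (intro boxwise_lipschitz_sum boxwise_lipschitz_mult boxwise_lipschitz_prod boxwise_lipschitz_power
      boxwise_lipschitz_const assms, assumption)+

text \<open>
  The coefficients that are eliminated are those of \<open>x\<^sub>k\<^sup>D\<close> in each active form of degree \<open>D\<close>, and
  those of \<open>x\<^sub>k\<^sup>e x\<^sub>i\<close>, \<open>i \<noteq> k\<close>, \<open>e = D l - 1\<close>, in the \<open>l\<close>-th form. The equation for the \<open>i\<close>-th partial
  derivative determines the coefficient of \<open>x\<^sub>k\<^sup>e x\<^sub>i\<close>, because pure powers of \<open>x\<^sub>k\<close> and the other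
  eliminated monomials have zero partial derivative in \<open>x\<^sub>i\<close>. After that, vanishing of each active
  form determines its coefficient of \<open>x\<^sub>k\<^sup>D\<close>. With \<open>a = card A\<close>, this eliminates \<open>a + n - 1\<close> coefficients at the cost of \<open>n - 1\<close>
  coordinates and \<open>a - 1\<close> multipliers. The injection \<open>\<theta>\<close> places the coefficients of the system
  in an arbitrary index set.
\<close>

lemma null_dependent_gradients:
  fixes D :: "'c \<Rightarrow> nat" and \<theta> :: "'c \<times> ('n::finite \<Rightarrow>\<^sub>0 nat) \<Rightarrow> 'j" and \<sigma> :: real
  assumes A: "finite A" "l \<in> A" "D l \<ge> 1" and "\<sigma> \<noteq> 0" and "finite J"
    and inj: "inj_on \<theta> (SIGMA c:A. monos_upto (D c))"
    and \<theta>J: "\<theta> ` (SIGMA c:A. monos_upto (D c)) \<subseteq> J"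
  defines "co z c \<equiv> (\<lambda>\<alpha>. z (\<theta> (c, \<alpha>)))"
  shows "{z \<in> extensional J. \<exists>x \<mu>. x $ k = \<sigma> \<and> (\<forall>c\<in>A. form (D c) (co z c) x = 0) \<and>
            (\<forall>i. i \<noteq> k \<longrightarrow> form_partial i (D l) (co z l) x =
               (\<Sum>c\<in>A - {l}. \<mu> c * form_partial i (D c) (co z c) x))}
         \<in> null_sets (completion (coeff_measure J))" (is "?Z \<in> _")
proof -
  define \<beta> where "\<beta> i = single k (D l - 1) + single i 1" for i :: 'n
  define ka where "ka c = \<theta> (c, single k (D c))" for c
  define kb where "kb i = \<theta> (l, \<beta> i)" for i
  define I where "I = UNIV - {k}"
  define K where "K = ka ` A \<union> kb ` I"
  have \<beta>_lookup: "Poly_Mapping.lookup (\<beta> i) j = (if j = k then D l - 1 else 0) + (if j = i then 1 else 0)" for i j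
    by (auto simp: \<beta>_def lookup_add lookup_single when_def)
  have \<beta>_mono: "\<beta> i \<in> monos_of (D l)" if "i \<in> I" for i
    using A(3) that by (simp add: monos_of_def mono_degree_def \<beta>_lookup sum.distrib)
  have \<beta>_inj: "i = j" if "\<beta> i = \<beta> j" for i j
  proof -
    have "Poly_Mapping.lookup (single i 1) i = Poly_Mapping.lookup (single j (1::nat)) i" using that by (simp add: \<beta>_def)
    then show ?thesis by (simp add: lookup_single when_def split: if_splits)
  qed
  have \<beta>_ne: "\<beta> i \<noteq> single k d" if "i \<in> I" for i d
  proof
    assume "\<beta> i = single k d"
    then have "Poly_Mapping.lookup (\<beta> i) i = Poly_Mapping.lookup (single k d) i" by simp
    then show False using that by (simp add: \<beta>_lookup lookup_single when_def I_def split: if_splits)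
  qed
  have \<theta>_eq: "c = c' \<and> \<alpha> = \<alpha>'"
    if "\<theta> (c, \<alpha>) = \<theta> (c', \<alpha>')" "c \<in> A" "c' \<in> A" "\<alpha> \<in> monos_of (D c)" "\<alpha>' \<in> monos_of (D c')" for c c' \<alpha> \<alpha>'
    using inj_onD[OF inj that(1)] that(2-) monos_of_subset by auto
  have \<theta>_in: "\<theta> (c, \<alpha>) \<in> J" if "c \<in> A" "\<alpha> \<in> monos_of (D c)" for c \<alpha>
    using \<theta>J that monos_of_subset by fastforce
  have ka_inj: "inj_on ka A" using \<theta>_eq single_mem_monos_of by (fastforce simp: inj_on_def ka_def)
  have kb_inj: "inj_on kb I" using \<theta>_eq \<beta>_mono \<beta>_inj A(2) by (metis (no_types, lifting) inj_onI kb_def)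
  have \<theta>_ka: "\<theta> (c, \<alpha>) \<in> ka ` A \<longleftrightarrow> \<alpha> = single k (D c)" if "c \<in> A" "\<alpha> \<in> monos_of (D c)" for c \<alpha>
    using \<theta>_eq[OF _ that(1) _ that(2)] single_mem_monos_of that by (auto simp: ka_def)
  have \<theta>_kb: "\<theta> (c, \<alpha>) \<in> kb ` I \<longleftrightarrow> c = l \<and> \<alpha> \<in> \<beta> ` I" if "c \<in> A" "\<alpha> \<in> monos_of (D c)" for c \<alpha>
    using \<theta>_eq[OF _ that(1) A(2) that(2)] \<beta>_mono by (auto simp: kb_def)
  have disj: "ka ` A \<inter> kb ` I = {}"
  proof -
    have "ka c \<notin> kb ` I" if "c \<in> A" for c
      using \<theta>_kb[OF that single_mem_monos_of[of k]] \<beta>_ne[of _ "D c"] by (force simp: ka_def)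
    then show ?thesis by auto
  qed
  have KJ: "K \<subseteq> J"
    using \<theta>_in single_mem_monos_of \<beta>_mono A(2) by (auto simp: K_def ka_def kb_def)
  have cardK: "card K = card A + card I"
    unfolding K_def using A(1) disj by (subst card_Un_disjoint) (auto simp: card_image ka_inj kb_inj)
  define P :: "('j + 'n + 'c) set" where "P = Inl ` (J - K) \<union> (Inr ` Inl ` I \<union> Inr ` Inr ` (A - {l}))"
  have "finite P" unfolding P_def using \<open>finite J\<close> A(1) by simp
  have "card P = card (J - K) + (card I + (card A - 1))"
    unfolding P_def using \<open>finite J\<close> A(1,2)
    by (subst card_Un_disjoint; (subst card_Un_disjoint)?) (auto simp: card_image inj_on_def image_image)
  moreover have "card (J - K) + card K = card J"
    using KJ \<open>finite J\<close> by (metis card_Diff_subset card_mono finite_subset le_add_diff_inverse2)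
  moreover have "card A > 0" using A by (auto simp: card_gt_0_iff)
  ultimately have cardP: "card P < card J" using cardK by linarith

  \<comment> \<open>The point, the multipliers and the remaining coefficients are read off the
    parameters \<open>u\<close>. Eliminated coefficients count as \<open>0\<close> in \<open>W\<close>, and
    only the pure powers do in \<open>W'\<close>.\<close>
  define X where "X u = (\<chi> i. if i = k then \<sigma> else u (Inr (Inl i)))" for u :: "'j + 'n + 'c \<Rightarrow> real"
  define W where "W u c \<alpha> = (if \<theta> (c, \<alpha>) \<in> K then 0 else u (Inl (\<theta> (c, \<alpha>))))" for u :: "'j + 'n + 'c \<Rightarrow> real" and c \<alpha>
  define b where "b i u = ((\<Sum>c\<in>A - {l}. u (Inr (Inr c)) * form_partial i (D c) (W u c) (X u))
      - form_partial i (D l) (W u l) (X u)) * (1 / \<sigma> ^ (D l - 1))" for i u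
  define W' where "W' u c \<alpha> = (if \<theta> (c, \<alpha>) \<in> kb ` I then b (inv_into I kb (\<theta> (c, \<alpha>))) u else W u c \<alpha>)" for u c \<alpha>
  define a where "a c u = (0 - form (D c) (W' u c) (X u)) * (1 / \<sigma> ^ D c)" for c u
  define \<Phi> where "\<Phi> j = (if j \<in> ka ` A then a (inv_into A ka j)
     else if j \<in> kb ` I then b (inv_into I kb j) else (\<lambda>u. u (Inl j)))" for j

  have lip_X: "boxwise_lipschitz P (\<lambda>u. X u $ i)" for i
    unfolding X_def by (cases "i = k") (auto simp: P_def I_def)
  have lip_W: "boxwise_lipschitz P (\<lambda>u. W u c \<alpha>)" if "c \<in> A" "\<alpha> \<in> monos_of (D c)" for c \<alpha>
    unfolding W_def using \<theta>_in[OF that] by (cases "\<theta> (c, \<alpha>) \<in> K") (auto simp: P_def)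
  have lip_b: "boxwise_lipschitz P (b i)" for i
    unfolding b_def[abs_def]
    by (intro boxwise_lipschitz_mult boxwise_lipschitz_diff boxwise_lipschitz_sum boxwise_lipschitz_coord
        boxwise_lipschitz_form lip_X lip_W boxwise_lipschitz_const) (use A(2) in \<open>auto simp: P_def\<close>)
  have lip_W': "boxwise_lipschitz P (\<lambda>u. W' u c \<alpha>)" if "c \<in> A" "\<alpha> \<in> monos_of (D c)" for c \<alpha>
    unfolding W'_def using lip_b lip_W[OF that] by (cases "\<theta> (c, \<alpha>) \<in> kb ` I") auto
  have lip_a: "boxwise_lipschitz P (a c)" if "c \<in> A" for c
    unfolding a_def[abs_def]
    by (intro boxwise_lipschitz_mult boxwise_lipschitz_diff boxwise_lipschitz_form lip_X lip_W' boxwise_lipschitz_const that)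
  have lip: "boxwise_lipschitz P (\<Phi> j)" if "j \<in> J" for j
    unfolding \<Phi>_def using that lip_a lip_b
    by (auto simp: inv_into_into K_def P_def intro: boxwise_lipschitz_coord)

  have mp_single: "monomial_partial i (single k e) x = 0" if "i \<in> I" for i e and x :: "real ^ 'n"
    using that by (simp add: monomial_partial_def lookup_single I_def when_def)
  have mp_\<beta>: "monomial_partial i (\<beta> i') x = (if i = i' then (x $ k) ^ (D l - 1) else 0)"
    if "i \<in> I" "i' \<in> I" for i i' and x :: "real ^ 'n"
  proof (cases "i = i'")
    case True
    have "(\<Prod>j\<in>UNIV - {i}. (x $ j) ^ Poly_Mapping.lookup (\<beta> i) j) =
        (\<Prod>j\<in>UNIV - {i}. if j = k then (x $ k) ^ (D l - 1) else 1)"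
      by (intro prod.cong) (auto simp: \<beta>_lookup)
    then show ?thesis using True that by (auto simp: monomial_partial_def \<beta>_lookup I_def)
  qed (use that in \<open>auto simp: monomial_partial_def \<beta>_lookup I_def\<close>)

  have "\<exists>u. \<forall>j\<in>J. z j = \<Phi> j u" if z: "z \<in> ?Z" for z
  proof -
    obtain x \<mu> where x: "x $ k = \<sigma>" "\<And>c. c \<in> A \<Longrightarrow> form (D c) (co z c) x = 0"
      "\<And>i. i \<noteq> k \<Longrightarrow> form_partial i (D l) (co z l) x =
               (\<Sum>c\<in>A - {l}. \<mu> c * form_partial i (D c) (co z c) x)"
      using z by blast
    define u where "u = case_sum z (case_sum (($) x) \<mu>)"
    have u_\<mu>: "u (Inr (Inr c)) = \<mu> c" for c by (simp add: u_def)
    have Xu: "X u = x" using x(1) by (auto simp: X_def u_def vec_eq_iff)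
    have W_other: "form_partial i (D c) (W u c) x = form_partial i (D c) (co z c) x" if c: "c \<in> A - {l}" and i: "i \<in> I" for c i
      unfolding form_partial_def
    proof (intro sum.cong refl)
      fix \<alpha> :: "'n \<Rightarrow>\<^sub>0 nat" assume "\<alpha> \<in> monos_of (D c)"
      then have "\<alpha> = single k (D c) \<or> \<theta> (c, \<alpha>) \<notin> K" using c \<theta>_ka \<theta>_kb by (auto simp: K_def)
      then show "W u c \<alpha> * monomial_partial i \<alpha> x = co z c \<alpha> * monomial_partial i \<alpha> x"
        using mp_single[OF i] by (auto simp: W_def co_def u_def)
    qed
    have W_l: "form_partial i (D l) (co z l) x = form_partial i (D l) (W u l) x + z (kb i) * \<sigma> ^ (D l - 1)" if i: "i \<in> I" for i
    proof -
      have "form_partial i (D l) (co z l) x = (\<Sum>\<alpha>\<in>monos_of (D l). W u l \<alpha> * monomial_partial i \<alpha> x +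
          (if \<alpha> = \<beta> i then z (kb i) * \<sigma> ^ (D l - 1) else 0))"
        unfolding form_partial_def
      proof (intro sum.cong refl)
        fix \<alpha> :: "'n \<Rightarrow>\<^sub>0 nat" assume \<alpha>: "\<alpha> \<in> monos_of (D l)"
        consider i' where "i' \<in> I" "\<alpha> = \<beta> i'" | "\<alpha> = single k (D l)" | "\<theta> (l, \<alpha>) \<notin> K" "\<alpha> \<notin> \<beta> ` I"
          using \<theta>_ka[OF A(2) \<alpha>] \<theta>_kb[OF A(2) \<alpha>] by (auto simp: K_def)
        then show "co z l \<alpha> * monomial_partial i \<alpha> x = W u l \<alpha> * monomial_partial i \<alpha> x +
            (if \<alpha> = \<beta> i then z (kb i) * \<sigma> ^ (D l - 1) else 0)"
        proof cases
          case 1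
          then have "\<theta> (l, \<alpha>) \<in> K" by (auto simp: K_def kb_def)
          then show ?thesis using 1 i \<beta>_inj x(1) by (auto simp: mp_\<beta> W_def co_def kb_def)
        next
          case 2
          then show ?thesis using mp_single[OF i] \<beta>_ne[OF i, of "D l"] by auto
        next
          case 3
          then show ?thesis using i by (auto simp: W_def co_def u_def)
        qed
      qed
      then show ?thesis using \<beta>_mono[OF i] by (simp add: sum.distrib form_partial_def finite_monos_of)
    qed
    have b: "b i u = z (kb i)" if i: "i \<in> I" for i
    proof -
      have "(\<Sum>c\<in>A - {l}. \<mu> c * form_partial i (D c) (W u c) x) = (\<Sum>c\<in>A - {l}. \<mu> c * form_partial i (D c) (co z c) x)"
        using W_other i by (intro sum.cong) auto
      then have "b i u = (form_partial i (D l) (co z l) x - form_partial i (D l) (W u l) x) * (1 / \<sigma> ^ (D l - 1))"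
        using x(3)[of i] i by (simp add: b_def Xu I_def u_\<mu>)
      then show ?thesis using W_l[OF i] \<open>\<sigma> \<noteq> 0\<close> by simp
    qed
    have W': "W' u c \<alpha> = (if \<alpha> = single k (D c) then 0 else co z c \<alpha>)" if c: "c \<in> A" "\<alpha> \<in> monos_of (D c)" for c \<alpha>
    proof (cases "\<theta> (c, \<alpha>) \<in> kb ` I")
      case True
      then have "\<theta> (c, \<alpha>) \<notin> ka ` A" using disj by auto
      then show ?thesis
        using True b[OF inv_into_into[OF True]] \<theta>_ka[OF c] by (simp add: W'_def f_inv_into_f co_def)
    next
      case False
      then show ?thesis using \<theta>_ka[OF c] by (auto simp: W'_def W_def K_def co_def u_def)
    qed
    have a: "a c u = z (ka c)" if c: "c \<in> A" for c
    proof -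
      have "form (D c) (co z c) x = (\<Sum>\<alpha>\<in>monos_of (D c). W' u c \<alpha> * monomial \<alpha> x +
          (if \<alpha> = single k (D c) then z (ka c) * \<sigma> ^ D c else 0))"
        unfolding form_def using c by (intro sum.cong) (auto simp: W' monomial_single x(1) co_def ka_def)
      also have "\<dots> = form (D c) (W' u c) x + z (ka c) * \<sigma> ^ D c"
        by (simp add: sum.distrib form_def finite_monos_of single_mem_monos_of)
      finally have "0 - form (D c) (W' u c) x = z (ka c) * \<sigma> ^ D c" using x(2)[OF c] by simp
      then show ?thesis using \<open>\<sigma> \<noteq> 0\<close> by (simp add: a_def Xu)
    qed
    have "z j = \<Phi> j u" for j
    proof -
      consider "j \<in> ka ` A" | "j \<notin> ka ` A" "j \<in> kb ` I" | "j \<notin> K" by (auto simp: K_def)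
      then show ?thesis
      proof cases
        case 1 then show ?thesis using a[OF inv_into_into[OF 1]] by (simp add: \<Phi>_def f_inv_into_f)
      next
        case 2 then show ?thesis using b[OF inv_into_into[OF 2(2)]] by (simp add: \<Phi>_def f_inv_into_f)
      next
        case 3 then show ?thesis by (auto simp: \<Phi>_def K_def u_def)
      qed
    qed
    then show ?thesis by blast
  qed
  then show ?thesis
    by (intro null_image[OF \<open>finite J\<close> \<open>finite P\<close> cardP lip]) auto
qed

text \<open>
  The first condition makes the parts of prescribed degree the highest components and excludes
  active constraints of degree \<open>0\<close>. The second is transversality at infinity: since the equations
  are homogeneous, it suffices to look at the charts \<open>x\<^sub>k = \<plusminus>1\<close>, where the \<open>k\<close>-th partial
  derivative can be left out.
\<close>

definition regular_at_infinity ::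
  "'c set \<Rightarrow> ('c \<Rightarrow> nat) \<Rightarrow> ('c \<Rightarrow> ('n::finite \<Rightarrow>\<^sub>0 nat) \<Rightarrow> real) \<Rightarrow> bool" where
  "regular_at_infinity I D w \<longleftrightarrow>
     (\<forall>c\<in>I. \<forall>k. w c (single k (D c)) \<noteq> 0) \<and>
     (\<forall>A\<subseteq>I. \<forall>l\<in>A. \<forall>k. \<forall>\<sigma>\<in>{1, -1}. D l \<ge> 1 \<longrightarrow>
        (\<nexists>x \<mu>. x $ k = \<sigma> \<and> (\<forall>c\<in>A. form (D c) (w c) x = 0) \<and>
            (\<forall>i. i \<noteq> k \<longrightarrow> form_partial i (D l) (w l) x =
               (\<Sum>c\<in>A - {l}. \<mu> c * form_partial i (D c) (w c) x))))"

lemma regular_at_infinity_cong: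
  fixes w :: "'c \<Rightarrow> ('n::finite \<Rightarrow>\<^sub>0 nat) \<Rightarrow> real"
  assumes eq: "\<And>c \<alpha>. c \<in> I \<Longrightarrow> \<alpha> \<in> monos_of (D c) \<Longrightarrow> w c \<alpha> = w' c \<alpha>"
    and reg: "regular_at_infinity I D w"
  shows "regular_at_infinity I D w'"
proof -
  have eqs: "w' c (single k (D c)) = w c (single k (D c))" "form (D c) (w' c) x = form (D c) (w c) x"
    "form_partial i (D c) (w' c) x = form_partial i (D c) (w c) x" if "c \<in> I" for c k i x
    using eq[OF that] single_mem_monos_of[of k "D c"] form_cong[of "D c" "w c" "w' c"] form_partial_cong[of "D c" "w c" "w' c"]
    by auto
  have "\<nexists>x \<mu>. x $ k = \<sigma> \<and> (\<forall>c\<in>A. form (D c) (w' c) x = 0) \<and>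
            (\<forall>i. i \<noteq> k \<longrightarrow> form_partial i (D l) (w' l) x =
               (\<Sum>c\<in>A - {l}. \<mu> c * form_partial i (D c) (w' c) x))"
    if A: "A \<subseteq> I" "l \<in> A" "\<sigma> \<in> {1, -1}" "D l \<ge> 1" for A l k \<sigma>
  proof -
    have "(\<Sum>c\<in>A - {l}. \<mu> c * form_partial i (D c) (w' c) x) =
        (\<Sum>c\<in>A - {l}. \<mu> c * form_partial i (D c) (w c) x)" for \<mu> i x
      using A(1) by (intro sum.cong refl) (auto simp: eqs)
    moreover have "(\<forall>c\<in>A. form (D c) (w' c) x = 0) \<longleftrightarrow> (\<forall>c\<in>A. form (D c) (w c) x = 0)" for x
      by (intro ball_cong refl, subst eqs(2)) (use A(1) in auto)
    moreover have "form_partial i (D l) (w' l) x = form_partial i (D l) (w l) x" for i x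
      using A(1,2) eqs(3) by auto
    moreover have "\<nexists>x \<mu>. x $ k = \<sigma> \<and> (\<forall>c\<in>A. form (D c) (w c) x = 0) \<and>
            (\<forall>i. i \<noteq> k \<longrightarrow> form_partial i (D l) (w l) x =
               (\<Sum>c\<in>A - {l}. \<mu> c * form_partial i (D c) (w c) x))"
      using reg A unfolding regular_at_infinity_def by blast
    ultimately show ?thesis by simp
  qed
  then show ?thesis using reg eqs(1) unfolding regular_at_infinity_def by simp
qed

lemma null_not_regular_at_infinity:
  fixes D :: "'c \<Rightarrow> nat" and \<theta> :: "'c \<times> ('n::finite \<Rightarrow>\<^sub>0 nat) \<Rightarrow> 'j"
  assumes I: "finite I" and "finite J"
    and inj: "inj_on \<theta> (SIGMA c:I. monos_upto (D c))"
    and \<theta>J: "\<theta> ` (SIGMA c:I. monos_upto (D c)) \<subseteq> J"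
  shows "{z \<in> extensional J. \<not> regular_at_infinity I D (\<lambda>c \<alpha>. z (\<theta> (c, \<alpha>)))}
         \<in> null_sets (completion (coeff_measure J))" (is "?Z \<in> _")
proof -
  define H where "H e = {z \<in> extensional J. z e = (0::real)}" for e
  define bad where "bad A l k \<sigma> = {z \<in> extensional J. \<exists>x \<mu>. x $ k = \<sigma> \<and>
      (\<forall>c\<in>A. form (D c) (\<lambda>\<alpha>. z (\<theta> (c, \<alpha>))) x = 0) \<and>
      (\<forall>i. i \<noteq> k \<longrightarrow> form_partial i (D l) (\<lambda>\<alpha>. z (\<theta> (l, \<alpha>))) x =
         (\<Sum>c\<in>A - {l}. \<mu> c * form_partial i (D c) (\<lambda>\<alpha>. z (\<theta> (c, \<alpha>))) x))}" for A l and k :: 'n and \<sigma>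
  have H: "H (\<theta> (c, single k (D c))) \<in> null_sets (completion (coeff_measure J))" if "c \<in> I" for c k
    unfolding H_def using that \<theta>J single_mem_monos_of monos_of_subset
    by (intro null_hyperplane[OF \<open>finite J\<close>]) fastforce
  have bad: "bad A l k \<sigma> \<in> null_sets (completion (coeff_measure J))"
    if "A \<subseteq> I" "l \<in> A" "D l \<ge> 1" "\<sigma> \<in> {1, -1}" for A l k \<sigma>
  proof -
    have sub: "(SIGMA c:A. monos_upto (D c)) \<subseteq> (SIGMA c:I. monos_upto (D c))" using that(1) by auto
    have "\<sigma> \<noteq> 0" using that(4) by auto
    show ?thesis
      unfolding bad_def
      by (rule null_dependent_gradients[OF finite_subset[OF that(1) I] that(2,3) \<open>\<sigma> \<noteq> 0\<close> \<open>finite J\<close>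
            inj_on_subset[OF inj sub] order_trans[OF image_mono[OF sub] \<theta>J]])
  qed
  have "?Z \<subseteq> (\<Union>c\<in>I. \<Union>k. H (\<theta> (c, single k (D c)))) \<union>
      (\<Union>A\<in>Pow I. \<Union>l\<in>{l \<in> A. D l \<ge> 1}. \<Union>k. \<Union>\<sigma>\<in>{1, -1}. bad A l k \<sigma>)" (is "_ \<subseteq> ?H \<union> ?B")
  proof
    fix z assume "z \<in> ?Z"
    then have z: "z \<in> extensional J" "\<not> regular_at_infinity I D (\<lambda>c \<alpha>. z (\<theta> (c, \<alpha>)))" by auto
    show "z \<in> ?H \<union> ?B"
    proof (rule ccontr)
      assume no: "z \<notin> ?H \<union> ?B"
      have pure: "z (\<theta> (c, single k (D c))) \<noteq> 0" if "c \<in> I" for c k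
        using no z(1) that by (auto simp: H_def)
      have notbad: "z \<notin> bad A l k \<sigma>" if "A \<subseteq> I" "l \<in> A" "\<sigma> \<in> {1, -1}" "D l \<ge> 1" for A l k \<sigma>
      proof
        assume "z \<in> bad A l k \<sigma>"
        then have "z \<in> (\<Union>\<sigma>\<in>{1, -1}. bad A l k \<sigma>)" using that(3) by (rule UN_I[rotated])
        then have "z \<in> (\<Union>k. \<Union>\<sigma>\<in>{1, -1}. bad A l k \<sigma>)" by (rule UN_I[rotated]) simp
        then have "z \<in> (\<Union>l\<in>{l \<in> A. D l \<ge> 1}. \<Union>k. \<Union>\<sigma>\<in>{1, -1}. bad A l k \<sigma>)"
          by (rule UN_I[rotated]) (use that in simp)
        then have "z \<in> ?B" by (rule UN_I[rotated]) (use that in simp)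
        then show False using no by simp
      qed
      have "\<nexists>x \<mu>. x $ k = \<sigma> \<and> (\<forall>c\<in>A. form (D c) (\<lambda>\<alpha>. z (\<theta> (c, \<alpha>))) x = 0) \<and>
            (\<forall>i. i \<noteq> k \<longrightarrow> form_partial i (D l) (\<lambda>\<alpha>. z (\<theta> (l, \<alpha>))) x =
               (\<Sum>c\<in>A - {l}. \<mu> c * form_partial i (D c) (\<lambda>\<alpha>. z (\<theta> (c, \<alpha>))) x))"
        if "A \<subseteq> I" "l \<in> A" "\<sigma> \<in> {1, -1}" "D l \<ge> 1" for A l k \<sigma>
        using notbad[OF that] by (simp only: bad_def mem_Collect_eq z(1) simp_thms)
      then have "regular_at_infinity I D (\<lambda>c \<alpha>. z (\<theta> (c, \<alpha>)))"
        unfolding regular_at_infinity_def using pure by simp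
      then show False using z(2) by simp
    qed
  qed
  moreover have "(\<Union>c\<in>I. \<Union>k. H (\<theta> (c, single k (D c)))) \<union>
      (\<Union>A\<in>Pow I. \<Union>l\<in>{l \<in> A. D l \<ge> 1}. \<Union>k. \<Union>\<sigma>\<in>{1, -1}. bad A l k \<sigma>)
      \<in> null_sets (completion (coeff_measure J))"
    using I by (intro null_sets.Un null_sets_UN' H bad) (auto intro: countable_finite finite_subset)
  ultimately show ?thesis by (rule null_sets_completion_subset)
qed

section \<open>Generic positivity\<close>

text \<open>
  Regularity gives \<open>p\<^sub>d \<ge> 0\<close> on the cone of the highest components, and the forms that in addition
  vanish somewhere on it off the origin are exceptional. Rescaling to \<open>x\<^sub>k = \<plusminus>1\<close> leaves finitely many
  exceptional sets.
\<close>

lemma generic_poly_if_regular: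
  fixes g h :: "nat \<Rightarrow> 'n::finite mpoly"
  assumes "d > 0"
    and g: "\<And>i. i < m \<Longrightarrow> g i \<in> polys_upto (dg i)" and h: "\<And>j. j < r \<Longrightarrow> h j \<in> polys_upto (dh j)"
    and reg: "regular_at_infinity ({..<m} <+> {..<r}) (case_sum dg dh) (\<lambda>c. Poly_Mapping.lookup (case_sum g h c))"
  shows "generic_poly d {p. bdd_below (peval p ` semialg_set m r g h)}
         (\<lambda>p. \<forall>x \<in> semialg_set m r (highest_component \<circ> g) (highest_component \<circ> h) - {0}.
                peval (highest_component p) x > 0)"
proof -
  define tS where "tS = semialg_set m r (highest_component \<circ> g) (highest_component \<circ> h)"
  define I where "I = {..<m} <+> {..<r}"
  define D where "D = case_sum dg dh"
  define f where "f = case_sum g h"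
  define F where "F c = form (D c) (Poly_Mapping.lookup (f c))" for c
  have "finite I" by (simp add: I_def)
  have f: "f c \<in> polys_upto (D c)" if "c \<in> I" for c
    using that g h by (auto simp: I_def f_def D_def)
  have reg: "regular_at_infinity I D (\<lambda>c. Poly_Mapping.lookup (f c))"
    using reg by (simp add: I_def D_def f_def)
  have pure: "Poly_Mapping.lookup (f c) (single k (D c)) \<noteq> 0" if "c \<in> I" for c k
    using reg that by (auto simp: regular_at_infinity_def)
  have top: "peval (highest_component (f c)) x = F c x" if "c \<in> I" for c x
    using highest_component_eq[OF f[OF that] pure[OF that]] by (simp add: peval_hom_component F_def)
  have S: "x \<in> tS \<longleftrightarrow> (\<forall>i<m. F (Inl i) x \<ge> 0) \<and> (\<forall>j<r. F (Inr j) x = 0)" for x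
  proof -
    have "F (Inl i) x = peval (highest_component (g i)) x" if "i < m" for i
    proof -
      have "Inl i \<in> I" using that by (auto simp: I_def)
      then show ?thesis using top[of "Inl i" x] by (simp add: f_def)
    qed
    moreover have "F (Inr j) x = peval (highest_component (h j)) x" if "j < r" for j
    proof -
      have "Inr j \<in> I" using that by (auto simp: I_def)
      then show ?thesis using top[of "Inr j" x] by (simp add: f_def)
    qed
    ultimately show ?thesis by (simp add: tS_def semialg_set_def)
  qed
  have S_scale: "t *\<^sub>R x \<in> tS" if "x \<in> tS" "t > 0" for x t
    using that by (auto simp: S F_def form_scaleR intro!: mult_nonneg_nonneg)

  have nonneg: "form d (Poly_Mapping.lookup p) x \<ge> 0"
    if p: "p \<in> polys_upto d" "bdd_below (peval p ` semialg_set m r g h)"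
      and x: "x \<in> tS" "x $ k = \<sigma>" "\<sigma> \<in> {1, -1}" for p x k \<sigma>
  proof -
    \<comment> \<open>All equalities belong to \<open>A\<close>, together with the active inequalities.\<close>
    define A where "A = {c \<in> I. F c x = 0}"
    define B where "B = I - A"
    have "D c \<ge> 1" if c: "c \<in> A" for c
    proof (rule ccontr)
      assume "\<not> D c \<ge> 1"
      then have D0: "D c = 0" by simp
      have "monos_of 0 = {0 :: 'n \<Rightarrow>\<^sub>0 nat}"
        by (auto simp: monos_of_def mono_degree_def intro: poly_mapping_eqI)
      then have "F c x = Poly_Mapping.lookup (f c) 0" by (simp add: F_def form_def D0 monomial_def)
      then show False using c pure[of c undefined] D0 by (simp add: A_def)
    qed
    then have indep: "\<nexists>\<mu>. \<forall>i. i \<noteq> k \<longrightarrow> form_partial i (D l) (Poly_Mapping.lookup (f l)) x =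
        (\<Sum>c\<in>A - {l}. \<mu> c * form_partial i (D c) (Poly_Mapping.lookup (f c)) x)" if "l \<in> A" for l
    proof -
      have "A \<subseteq> I" "\<forall>c\<in>A. form (D c) (Poly_Mapping.lookup (f c)) x = 0" "D l \<ge> 1"
        using that \<open>\<And>c. c \<in> A \<Longrightarrow> D c \<ge> 1\<close> by (auto simp: A_def F_def)
      then show ?thesis using reg that x(2,3) unfolding regular_at_infinity_def by blast
    qed
    have "{y. (\<forall>c\<in>A. peval (f c) y = 0) \<and> (\<forall>c\<in>B. peval (f c) y \<ge> 0)} \<subseteq> semialg_set m r g h"
    proof
      fix y assume y: "y \<in> {y. (\<forall>c\<in>A. peval (f c) y = 0) \<and> (\<forall>c\<in>B. peval (f c) y \<ge> 0)}"
      have "peval (f c) y \<ge> 0" if "c \<in> I" for c using y that by (cases "c \<in> A") (auto simp: B_def)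
      then have "peval (g i) y \<ge> 0" if "i < m" for i using that by (force simp: I_def f_def)
      moreover have "Inr j \<in> A" if "j < r" for j using x(1) that by (auto simp: A_def S I_def)
      then have "peval (h j) y = 0" if "j < r" for j using y that by (force simp: f_def)
      ultimately show "y \<in> semialg_set m r g h" by (simp add: semialg_set_def)
    qed
    then have bdd: "bdd_below (peval p ` {y. (\<forall>c\<in>A. peval (f c) y = 0) \<and> (\<forall>c\<in>B. peval (f c) y \<ge> 0)})"
      by (intro bdd_below_mono[OF p(2)] image_mono)
    have pos: "F c x > 0" if c: "c \<in> B" for c
    proof -
      have "F c x \<ge> 0" using x(1) c by (force simp: B_def S I_def)
      then show ?thesis using c by (auto simp: A_def B_def)
    qed
    show ?thesis
    proof (rule form_nonneg_at_regular_direction[OF _ _ _ _ _ indep p(1) \<open>d > 0\<close> bdd])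
      show "finite A" "finite B" using \<open>finite I\<close> by (auto simp: A_def B_def)
      show "f c \<in> polys_upto (D c)" if "c \<in> A \<union> B" for c using that f by (auto simp: A_def B_def)
      show "form (D c) (Poly_Mapping.lookup (f c)) x = 0" if "c \<in> A" for c using that by (simp add: A_def F_def)
      show "form (D c) (Poly_Mapping.lookup (f c)) x > 0" if "c \<in> B" for c using pos[OF that] by (simp add: F_def)
    qed
  qed

  define X where "X k \<sigma> = {x \<in> tS. x $ k = \<sigma>}" for k \<sigma>
  define H where "H k = {z \<in> extensional (monos_upto d). z (single k d) = (0::real)}" for k :: 'n
  define Z where "Z k \<sigma> = {z \<in> extensional (monos_upto d).
      (\<forall>x\<in>X k \<sigma>. form d z x \<ge> 0) \<and> (\<exists>x\<in>X k \<sigma>. form d z x = 0)}" for k \<sigma>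
  have H: "H k \<in> null_sets (completion (coeff_measure (monos_upto d)))" for k
    unfolding H_def using monos_of_subset single_mem_monos_of by (intro null_hyperplane finite_monos_upto) auto
  have Z: "Z k \<sigma> \<in> null_sets (completion (coeff_measure (monos_upto d)))" if "\<sigma> \<in> {1, -1}" for k \<sigma>
    unfolding Z_def
  proof (rule null_touching_forms)
    show "\<sigma> ^ d * \<sigma> ^ d = 1" using that by (auto simp flip: power_mult_distrib)
    then show "\<sigma> ^ d * (x $ k) ^ d > 0" if "x \<in> X k \<sigma>" for x using that by (simp add: X_def)
  qed
  have exceptional: "restrict (Poly_Mapping.lookup p) (monos_upto d) \<in> (\<Union>k. H k) \<union> (\<Union>k. \<Union>\<sigma>\<in>{1, -1}. Z k \<sigma>)"
    if p: "p \<in> polys_upto d" "bdd_below (peval p ` semialg_set m r g h)"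
      and x: "x \<in> tS - {0}" "\<not> peval (highest_component p) x > 0" for p x
  proof (cases "\<exists>k. Poly_Mapping.lookup p (single k d) = 0")
    case True
    then show ?thesis using monos_of_subset[of d] single_mem_monos_of[of _ d] by (auto simp: H_def)
  next
    case False
    define z where "z = restrict (Poly_Mapping.lookup p) (monos_upto d)"
    have form_z: "form d z y = form d (Poly_Mapping.lookup p) y" for y
      using monos_of_subset[of d] by (intro form_cong) (auto simp: z_def)
    have "x \<noteq> 0" using x(1) by simp
    then obtain k where k: "x $ k \<noteq> 0" by (auto simp: vec_eq_iff)
    define x' where "x' = (1 / \<bar>x $ k\<bar>) *\<^sub>R x"
    define \<sigma> where "\<sigma> = sgn (x $ k)"
    have \<sigma>: "\<sigma> \<in> {1, -1}" using k by (auto simp: \<sigma>_def sgn_if)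
    have x': "x' \<in> tS" "x' $ k = \<sigma>"
      using x(1) k by (auto simp: x'_def \<sigma>_def sgn_if intro!: S_scale)
    have "form d (Poly_Mapping.lookup p) x \<le> 0"
      using x(2) False highest_component_eq[OF p(1)] by (simp add: peval_hom_component)
    then have "form d (Poly_Mapping.lookup p) x' \<le> 0"
      unfolding x'_def form_scaleR by (intro mult_nonneg_nonpos) auto
    then have "form d z x' = 0" using nonneg[OF p x' \<sigma>] by (simp add: form_z)
    moreover have "form d z y \<ge> 0" if "y \<in> X k \<sigma>" for y
      using nonneg[OF p _ _ \<sigma>, of y k] that by (simp add: form_z X_def)
    moreover have "z \<in> extensional (monos_upto d)" by (simp add: z_def)
    ultimately have "z \<in> Z k \<sigma>" using x' by (auto simp: Z_def X_def)
    then show ?thesis using \<sigma> unfolding z_def[symmetric] by blast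
  qed
  have null: "(\<Union>k. H k) \<union> (\<Union>k. \<Union>\<sigma>\<in>{1, -1}. Z k \<sigma>)
      \<in> null_sets (completion (coeff_measure (monos_upto d)))"
    by (intro null_sets.Un null_sets_UN' H Z) (auto intro: countable_finite)
  show ?thesis
    unfolding generic_poly_def generically_def tS_def[symmetric]
  proof (rule null_sets_completion_subset[OF subsetI null])
    fix z
    assume "z \<in> (\<lambda>p. restrict (Poly_Mapping.lookup p) (monos_upto d)) `
      {p \<in> {p. bdd_below (peval p ` semialg_set m r g h)} \<inter> polys_upto d.
        \<not> (\<forall>x\<in>tS - {0}. peval (highest_component p) x > 0)}"
    then obtain p x where "z = restrict (Poly_Mapping.lookup p) (monos_upto d)" "p \<in> polys_upto d"
      "bdd_below (peval p ` semialg_set m r g h)" "x \<in> tS - {0}" "\<not> peval (highest_component p) x > 0"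
      by blast
    then show "z \<in> (\<Union>k. H k) \<union> (\<Union>k. \<Union>\<sigma>\<in>{1, -1}. Z k \<sigma>)"
      using exceptional[of p x] by simp
  qed
qed

theorem corollary3:
  fixes m r d :: nat and dg dh :: "nat \<Rightarrow> nat"
  assumes "d > 0"
  shows "generic_system m r dg dh
    (\<lambda>g h :: nat \<Rightarrow> 'n::finite mpoly.
       generic_poly d {p. bdd_below (peval p ` semialg_set m r g h)}
         (\<lambda>p. \<forall>x \<in> semialg_set m r (highest_component \<circ> g) (highest_component \<circ> h) - {0}.
                peval (highest_component p) x > 0))"
proof -
  define I where "I = {..<m} <+> {..<r}"
  define D where "D = case_sum dg dh"
  define J :: "(nat \<times> ('n \<Rightarrow>\<^sub>0 nat) + nat \<times> ('n \<Rightarrow>\<^sub>0 nat)) set" where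
    "J = (SIGMA i:{..<m}. monos_upto (dg i)) <+> (SIGMA j:{..<r}. monos_upto (dh j))"
  define coef :: "(nat \<Rightarrow> 'n mpoly) \<times> (nat \<Rightarrow> 'n mpoly) \<Rightarrow> nat \<times> ('n \<Rightarrow>\<^sub>0 nat) + nat \<times> ('n \<Rightarrow>\<^sub>0 nat) \<Rightarrow> real" where
    "coef = (\<lambda>(g, h). case_sum (\<lambda>(i, \<alpha>). Poly_Mapping.lookup (g i) \<alpha>) (\<lambda>(j, \<alpha>). Poly_Mapping.lookup (h j) \<alpha>))"
  define \<theta> :: "(nat + nat) \<times> ('n \<Rightarrow>\<^sub>0 nat) \<Rightarrow> nat \<times> ('n \<Rightarrow>\<^sub>0 nat) + nat \<times> ('n \<Rightarrow>\<^sub>0 nat)" where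
    "\<theta> = (\<lambda>(c, \<alpha>). case c of Inl i \<Rightarrow> Inl (i, \<alpha>) | Inr j \<Rightarrow> Inr (j, \<alpha>))"
  have \<theta>: "\<theta> (c, \<alpha>) \<in> J" if "c \<in> I" "\<alpha> \<in> monos_upto (D c)" for c \<alpha>
    using that by (auto simp: \<theta>_def I_def D_def J_def)
  have null: "{z \<in> extensional J. \<not> regular_at_infinity I D (\<lambda>c \<alpha>. z (\<theta> (c, \<alpha>)))}
         \<in> null_sets (completion (coeff_measure J))"
  proof (rule null_not_regular_at_infinity)
    show "finite I" by (simp add: I_def)
    show "finite J" unfolding J_def by (intro finite_Plus finite_SigmaI finite_monos_upto) auto
    show "inj_on \<theta> (SIGMA c:I. monos_upto (D c))" by (auto simp: inj_on_def \<theta>_def split: sum.splits)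
    show "\<theta> ` (SIGMA c:I. monos_upto (D c)) \<subseteq> J" using \<theta> by auto
  qed
  have exceptional: "restrict (coef (g, h)) J \<in> {z \<in> extensional J. \<not> regular_at_infinity I D (\<lambda>c \<alpha>. z (\<theta> (c, \<alpha>)))}"
    if g: "g \<in> (\<Pi>\<^sub>E i\<in>{..<m}. polys_upto (dg i))" and h: "h \<in> (\<Pi>\<^sub>E j\<in>{..<r}. polys_upto (dh j))"
      and bad: "\<not> generic_poly d {p. bdd_below (peval p ` semialg_set m r g h)}
         (\<lambda>p. \<forall>x \<in> semialg_set m r (highest_component \<circ> g) (highest_component \<circ> h) - {0}.
                peval (highest_component p) x > 0)" for g h
  proof -
    have not_regular: "\<not> regular_at_infinity I D (\<lambda>c. Poly_Mapping.lookup (case_sum g h c))"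
    proof
      assume "regular_at_infinity I D (\<lambda>c. Poly_Mapping.lookup (case_sum g h c))"
      then show False
        using bad generic_poly_if_regular[OF assms PiE_mem[OF g] PiE_mem[OF h]] by (simp add: I_def D_def)
    qed
    have agree: "restrict (coef (g, h)) J (\<theta> (c, \<alpha>)) = Poly_Mapping.lookup (case_sum g h c) \<alpha>"
      if "c \<in> I" "\<alpha> \<in> monos_of (D c)" for c \<alpha>
    proof -
      have "\<theta> (c, \<alpha>) \<in> J" using \<theta> that monos_of_subset by blast
      then show ?thesis by (auto simp: coef_def \<theta>_def split: sum.splits)
    qed
    have "\<not> regular_at_infinity I D (\<lambda>c \<alpha>. restrict (coef (g, h)) J (\<theta> (c, \<alpha>)))"
    proof
      assume "regular_at_infinity I D (\<lambda>c \<alpha>. restrict (coef (g, h)) J (\<theta> (c, \<alpha>)))"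
      from regular_at_infinity_cong[OF agree this] not_regular show False by simp
    qed
    then show ?thesis by simp
  qed
  show ?thesis
    unfolding generic_system_def generically_def J_def[symmetric] coef_def[symmetric]
  proof (rule null_sets_completion_subset[OF image_subsetI null])
    fix q :: "(nat \<Rightarrow> 'n mpoly) \<times> (nat \<Rightarrow> 'n mpoly)"
    obtain g h where q: "q = (g, h)" by (cases q)
    assume "q \<in> {q \<in> (\<Pi>\<^sub>E i\<in>{..<m}. polys_upto (dg i)) \<times> (\<Pi>\<^sub>E j\<in>{..<r}. polys_upto (dh j)).
      \<not> (case q of (g, h) \<Rightarrow> generic_poly d {p. bdd_below (peval p ` semialg_set m r g h)}
         (\<lambda>p. \<forall>x \<in> semialg_set m r (highest_component \<circ> g) (highest_component \<circ> h) - {0}.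
                peval (highest_component p) x > 0))}"
    then show "restrict (coef q) J \<in> {z \<in> extensional J. \<not> regular_at_infinity I D (\<lambda>c \<alpha>. z (\<theta> (c, \<alpha>)))}"
      unfolding q mem_Collect_eq mem_Times_iff fst_conv snd_conv prod.case
      by (elim conjE) (rule exceptional[unfolded mem_Collect_eq])
  qed
qed

end
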